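(* Fix $n,m\in\mathbb{N}$ and $q>0$. For every (possibly randomized) allocation policy $\mathcal{A}$ and every (oblivious) request sequence $E\in\mathcal{E}_{n,m,q}$, there is an adaptive request sequence $E'$ with $n$ offline nodes, $m$ online nodes and total quantity $q$ such that, with probability $1$, $\textsc{WF}(E)\preceq\mathcal{A}(E')$ and $\textsc{OPT}(E)\succeq\textsc{OPT}(\mathcal{A},E')$.
   Context: Offline nodes are $[n]$. A (static) request sequence is $E=((N_t,q_t))_{t\in[m]}$ with nonempty $N_t\subseteq[n]$ and $q_t>0$; $\mathcal{E}_{n,m,q}$: such sequences with $\sum_tq_t=q$. $\Delta(N,q)=\{x\in\mathbb{R}^n_{\ge0}: x(i)=0\ \forall i\notin N,\ \sum_ix(i)=q\}$, $\Delta(E)=\sum_t\Delta(N_t,q_t)$ (Minkowski sum). An allocation policy $\mathcal{A}$ chooses, upon arrival of online node $t$, $x_t\in\Delta(N_t,q_t)$ as a function of the arrivals so far, its past allocations, and its internal randomness. An adaptive request sequence is a rule which, at each round $t$, chooses the $t$-th online node $(N_t,q_t)$ as a function of $(N_s,q_s)_{s<t}$ and the policy's realized allocations $(x_s)_{s<t}$; running $\mathcal{A}$ against adaptive $E'$ yields a (random) realized static sequence and allocations, with $\mathcal{A}(E')=\sum_tx_t$ and $\textsc{OPT}(\mathcal{A},E')$ the majorization-minimal element of $\Delta$ of the realized sequence. Majorization: for $x,y$ with equal sums, $x\succeq y$ (i.e. $y\preceq x$) iff for every $j$ the sum of the $j$ largest entries of $x$ is at least that of $y$. $\textsc{OPT}(E)$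 is the unique majorization-minimal element of $\Delta(E)$. Water-filling chooses, at arrival $t$, the unique $x_t\in\Delta(N_t,q_t)$ maximizing $\min_{i\in N_t}(x_t(i)+\sum_{s<t}x_s(i))$; $\textsc{WF}(E)=\sum_tx_t$. *)

theory Defs
  imports "HOL-Probability.Probability"
begin

text \<open>
  The offline nodes are \<open>{1..n}\<close>. A vector in \<open>\<real>\<^sup>n\<close> is a function on the natural numbers
  of which only the values on \<open>{1..n}\<close> matter; the vectors in \<open>Delta\<close> below vanish elsewhere.
  Histories are lists in chronological order, so round \<open>t\<close> sits at list index \<open>t - 1\<close>.
\<close>

type_synonym request = "nat set \<times> real"
type_synonym alloc = "nat \<Rightarrow> real"

definition is_request :: "nat \<Rightarrow> request \<Rightarrow> bool" where
  "is_request n e \<longleftrightarrow> fst e \<noteq> {} \<and> fst e \<subseteq> {1..n} \<and> snd e > 0"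

definition request_seqs :: "nat \<Rightarrow> nat \<Rightarrow> real \<Rightarrow> request list set" where
  "request_seqs n m q =
     {E. length E = m \<and> (\<forall>e\<in>set E. is_request n e) \<and> (\<Sum>e\<leftarrow>E. snd e) = q}"

definition Delta :: "nat \<Rightarrow> request \<Rightarrow> alloc set" where
  "Delta n e = {x. (\<forall>i. 0 \<le> x i) \<and> (\<forall>i. i \<notin> fst e \<longrightarrow> x i = 0) \<and> (\<Sum>i\<in>{1..n}. x i) = snd e}"

definition total :: "alloc list \<Rightarrow> alloc" where
  "total xs = (\<lambda>i. \<Sum>x\<leftarrow>xs. x i)"

definition Delta_seq :: "nat \<Rightarrow> request list \<Rightarrow> alloc set" where
  "Delta_seq n E = {total xs | xs. list_all2 (\<lambda>x e. x \<in> Delta n e) xs E}"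

definition sum_largest :: "nat \<Rightarrow> nat \<Rightarrow> alloc \<Rightarrow> real" where
  "sum_largest n j x = sum_list (take j (rev (sort (map x [1..<Suc n]))))"

definition majorizes :: "nat \<Rightarrow> alloc \<Rightarrow> alloc \<Rightarrow> bool" where
  "majorizes n x y \<longleftrightarrow>
     (\<Sum>i\<in>{1..n}. x i) = (\<Sum>i\<in>{1..n}. y i) \<and>
     (\<forall>j\<in>{1..n}. sum_largest n j x \<ge> sum_largest n j y)"

definition majorization_minimal :: "nat \<Rightarrow> alloc set \<Rightarrow> alloc \<Rightarrow> bool" where
  "majorization_minimal n D x \<longleftrightarrow>
     x \<in> D \<and> (\<forall>y\<in>D. majorizes n x y \<longrightarrow> majorizes n y x)"

definition OPT :: "nat \<Rightarrow> request list \<Rightarrow> alloc" where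
  "OPT n E = (THE x. majorization_minimal n (Delta_seq n E) x)"

text \<open>
  A deterministic policy receives the arrivals so far, the current one included as the last
  element, and its past allocations. A randomized policy is a family of deterministic ones
  indexed by the outcome of the internal randomness.
\<close>

type_synonym policy = "request list \<Rightarrow> alloc list \<Rightarrow> alloc"

definition allocation_policy :: "nat \<Rightarrow> policy \<Rightarrow> bool" where
  "allocation_policy n P \<longleftrightarrow>
     (\<forall>es xs e. (\<forall>d\<in>set es. is_request n d) \<and> is_request n e \<and>
        list_all2 (\<lambda>x d. x \<in> Delta n d) xs es \<longrightarrow> P (es @ [e]) xs \<in> Delta n e)"

text \<open>An adversary sees the past arrivals and the realized past allocations.\<close>

type_synonym adversary = "request list \<Rightarrow> alloc list \<Rightarrow> request"

fun run :: "policy \<Rightarrow> adversary \<Rightarrow> nat \<Rightarrow> request list \<times> alloc list" where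
  "run P F 0 = ([], [])"
| "run P F (Suc t) =
     (let (es, xs) = run P F t; e = F es xs in (es @ [e], xs @ [P (es @ [e]) xs]))"

definition realized_seq :: "policy \<Rightarrow> adversary \<Rightarrow> nat \<Rightarrow> request list" where
  "realized_seq P F m = fst (run P F m)"

definition final_alloc :: "policy \<Rightarrow> adversary \<Rightarrow> nat \<Rightarrow> alloc" where
  "final_alloc P F m = total (snd (run P F m))"

definition adaptive_request_seqs :: "nat \<Rightarrow> nat \<Rightarrow> real \<Rightarrow> adversary set" where
  "adaptive_request_seqs n m q =
     {F. \<forall>P. allocation_policy n P \<longrightarrow> realized_seq P F m \<in> request_seqs n m q}"

definition oblivious :: "request list \<Rightarrow> adversary" where
  "oblivious E = (\<lambda>es xs. E ! length es)"

definition water_filling :: "nat \<Rightarrow> policy" where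
  "water_filling n = (\<lambda>es xs. let e = last es in
     THE x. is_arg_max (\<lambda>x. Min ((\<lambda>i. x i + total xs i) ` fst e)) (\<lambda>x. x \<in> Delta n e) x)"

definition WF :: "nat \<Rightarrow> request list \<Rightarrow> alloc" where
  "WF n E = final_alloc (water_filling n) (oblivious E) (length E)"

end

theory Submission
  imports Defs
begin

text \<open>
  Let \<open>w\<close> be the final load of water-filling on \<open>E\<close> and \<open>\<mu> t\<close> the water level after round \<open>t\<close>.
  Enlarging each \<open>N\<^sub>t\<close> to \<open>{i. \<mu> t \<le> w i}\<close> and sorting the rounds by level turns \<open>E\<close> into a
  nested request sequence with a larger set of feasible loads. The adversary plays this
  nested sequence up to relabelling: it presents, inside the node set of the previous round, the
  required number of nodes that the policy has loaded most. Since relabelling does not change the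
  sorted optimal loads, the optimum is no more unbalanced than that of \<open>E\<close>. By averaging, the
  \<open>j\<close> largest loads of the policy sum to at least \<open>\<Sum>\<^sub>t q\<^sub>t min 1 (j / g\<^sub>t)\<close>, where \<open>g\<^sub>t\<close>
  is the number of nodes presented. Each unit of water of round \<open>t\<close> lies below height \<open>\<mu> t\<close>, and
  integrating over the height shows that the \<open>j\<close> largest entries of \<open>w\<close> sum to at most that.
\<close>

subsection \<open>Top sets and majorization\<close>

text \<open>A relation and not a function, because ties allow several top sets of the same size; the
  adversary may present any of them.\<close>

definition is_top :: "('a \<Rightarrow> real) \<Rightarrow> 'a set \<Rightarrow> 'a set \<Rightarrow> bool" where
  "is_top y T S \<longleftrightarrow> T \<subseteq> S \<and> (\<forall>i\<in>T. \<forall>l\<in>S - T. y l \<le> y i)"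

lemma is_top_exists:
  assumes "finite S" "k \<le> card S"
  shows "\<exists>T. is_top y T S \<and> card T = k"
  using assms(2)
proof (induction k)
  case 0
  then show ?case by (auto simp: is_top_def intro: exI[of _ "{}"])
next
  case (Suc k)
  then obtain T where T: "is_top y T S" "card T = k" by auto
  have "finite T" using T assms finite_subset by (auto simp: is_top_def)
  moreover have "T \<noteq> S" using T Suc.prems by auto
  ultimately have D: "finite (S - T)" "S - T \<noteq> {}" using T assms by (auto simp: is_top_def)
  then obtain i where i: "i \<in> S - T" "y i = Max (y ` (S - T))"
    by (metis (mono_tags, lifting) Max_in empty_is_image finite_imageI imageE)
  have "is_top y (insert i T) S"
    using T i D by (auto simp: is_top_def)
  moreover have "card (insert i T) = Suc k" using T i \<open>finite T\<close> by simp
  ultimately show ?case by blast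
qed

text \<open>Sum the hypothesis over all pairs in \<open>A \<times> B\<close>. The product form of
  this comparison of averages avoids division by cardinalities that may be zero.\<close>

lemma card_mult_sum_le:
  fixes y :: "'a \<Rightarrow> real"
  assumes "\<And>i l. i \<in> A \<Longrightarrow> l \<in> B \<Longrightarrow> y l \<le> y i"
  shows "card A * sum y B \<le> card B * sum y A"
proof -
  have "(\<Sum>i\<in>A. \<Sum>l\<in>B. y l) \<le> (\<Sum>i\<in>A. \<Sum>l\<in>B. y i)"
    using assms by (intro sum_mono) auto
  then show ?thesis by (simp add: sum_distrib_left)
qed

text \<open>In terms of averages: passing to a top subset does not lower the mean. Compare
  \<open>T\<close> with \<open>S - T\<close> and add \<open>card T * sum y T\<close> to both
  sides.\<close>

lemma is_top_average:
  fixes y :: "'a \<Rightarrow> real"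
  assumes "finite S" "is_top y T S"
  shows "card T * sum y S \<le> card S * sum y T"
proof -
  have T: "T \<subseteq> S" "finite T" using assms finite_subset by (auto simp: is_top_def)
  have "card T * sum y (S - T) \<le> card (S - T) * sum y T"
    using assms by (intro card_mult_sum_le) (auto simp: is_top_def)
  moreover have "sum y S = sum y T + sum y (S - T)"
    using T assms(1) by (simp add: sum.subset_diff)
  moreover have "real (card S) = card T + card (S - T)"
    using T assms(1) by (simp add: card_Diff_subset card_mono of_nat_diff)
  ultimately show ?thesis by (simp add: algebra_simps)
qed

text \<open>The common part cancels, and the differences \<open>T - T'\<close> and
  \<open>T' - T\<close> have equal size, so the pairwise comparison decides.\<close>

lemma is_top_sum_ge:
  fixes y :: "'a \<Rightarrow> real"
  assumes "finite S" "is_top y T S" "T' \<subseteq> S" "card T' = card T"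
  shows "sum y T' \<le> sum y T"
proof -
  have T: "T \<subseteq> S" "finite T" "finite T'"
    using assms finite_subset by (auto simp: is_top_def)
  have c: "card (T' - T) = card (T - T')"
    using T assms(4) by (simp add: card_Diff_subset_Int Int_commute)
  have "card (T - T') * sum y (T' - T) \<le> card (T' - T) * sum y (T - T')"
    using assms by (intro card_mult_sum_le) (auto simp: is_top_def)
  then have "sum y (T' - T) \<le> sum y (T - T')"
    using c T by (cases "card (T - T') = 0") auto
  moreover have "sum y T = sum y (T \<inter> T') + sum y (T - T')"
    using T by (simp add: sum.Int_Diff)
  moreover have "sum y T' = sum y (T \<inter> T') + sum y (T' - T)"
    using T by (metis Int_commute sum.Int_Diff)
  ultimately show ?thesis by simp
qed

text \<open>Bridge from sorted lists to sets of nodes: sorting the indices by key, instead of the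
  values, remembers which nodes carry the largest entries.\<close>

lemma sum_largest_top_exists:
  assumes "j \<le> n"
  shows "\<exists>T. is_top y T {1..n} \<and> card T = j \<and> sum_largest n j y = sum y T"
proof -
  define ls where "ls = rev (sort_key y [1..<Suc n])"
  have len: "length ls = n" and dist: "distinct ls" and set_ls: "set ls = {1..n}"
    by (auto simp: ls_def)
  have sort: "sort (map y [1..<Suc n]) = map y (sort_key y [1..<Suc n])"
    by (rule properties_for_sort) auto
  have sorted: "sorted_wrt (\<lambda>a b. y b \<le> y a) ls"
    using sorted_sort_key[of y "[1..<Suc n]"] 
    by (simp add: ls_def sorted_map sorted_wrt_rev del: sorted_sort_key)
  define T where "T = set (take j ls)"
  have "sum_largest n j y = sum_list (map y (take j ls))"
    unfolding sum_largest_def sort ls_def by (simp add: take_map rev_map)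
  also have "\<dots> = sum y T"
    using dist by (simp add: T_def sum_list_distinct_conv_sum_set)
  finally have 1: "sum_largest n j y = sum y T" .
  have 2: "card T = j"
    using assms len dist by (simp add: T_def distinct_card)
  have 3: "{1..n} - T \<subseteq> set (drop j ls)"
    using set_ls by (metis Diff_subset_conv T_def append_take_drop_id set_append subset_refl)
  have "sorted_wrt (\<lambda>a b. y b \<le> y a) (take j ls @ drop j ls)" using sorted by simp
  then have 4: "\<forall>i\<in>T. \<forall>l\<in>set (drop j ls). y l \<le> y i"
    unfolding sorted_wrt_append T_def by blast
  have "T \<subseteq> {1..n}" using set_ls set_take_subset T_def by metis
  then have "is_top y T {1..n}" using 3 4 by (auto simp: is_top_def)
  then show ?thesis using 1 2 by blast
qed

lemma sum_largest_ge:
  assumes "T \<subseteq> {1..n}"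
  shows "sum y T \<le> sum_largest n (card T) y"
proof -
  have "card T \<le> n" using assms card_mono[of "{1..n}" T] by simp
  then obtain T' where T': "is_top y T' {1..n}" "card T' = card T" "sum_largest n (card T) y = sum y T'"
    using sum_largest_top_exists by blast
  then show ?thesis using is_top_sum_ge[OF _ T'(1), of T] assms by simp
qed

lemma majorizes_trans: "majorizes n x y \<Longrightarrow> majorizes n y z \<Longrightarrow> majorizes n x z"
  unfolding majorizes_def by fastforce

text \<open>For any threshold \<open>\<theta>\<close>, the \<open>j\<close> largest entries of
  \<open>x\<close> sum to at most \<open>j * \<theta>\<close> plus the total excess of
  \<open>x\<close> over \<open>\<theta>\<close>; for \<open>y\<close> equality holds at a suitable
  \<open>\<theta>\<close>. The hypothesis on level sets compares the two excesses.\<close>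

lemma majorizes_level_sets:
  assumes total: "sum x {1..n} = sum y {1..n}"
    and level: "\<And>\<theta>. sum x {i\<in>{1..n}. \<theta> < x i} \<le> sum y {i\<in>{1..n}. \<theta> < x i}"
  shows "majorizes n y x"
  unfolding majorizes_def
proof (intro conjI ballI)
  show "sum y {1..n} = sum x {1..n}" using total by simp
  fix j assume j: "j \<in> {1..n}"
  obtain T where T: "is_top y T {1..n}" "card T = j" "sum_largest n j y = sum y T"
    using sum_largest_top_exists[of j n y] j by auto
  obtain T' where T': "is_top x T' {1..n}" "card T' = j" "sum_largest n j x = sum x T'"
    using sum_largest_top_exists[of j n x] j by auto
  have sub: "T \<subseteq> {1..n}" "T' \<subseteq> {1..n}" using T T' by (auto simp: is_top_def)
  have fin: "finite T" "finite T'" using sub finite_subset by auto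
  have "T \<noteq> {}" using T(2) j by auto
  \<comment> \<open>The \<open>j\<close>-th largest entry of \<open>y\<close>: the positive part of
    \<open>y i - \<theta>\<close> is \<open>y i - \<theta>\<close> itself on \<open>T\<close> and
    zero outside.\<close>
  define \<theta> where "\<theta> = Min (y ` T)"
  define U where "U = {i\<in>{1..n}. \<theta> < x i}"
  have \<theta>_le: "\<theta> \<le> y i" if "i \<in> T" for i using fin that by (simp add: \<theta>_def)
  have "\<theta> \<in> y ` T" using fin \<open>T \<noteq> {}\<close> unfolding \<theta>_def by (intro Min_in) auto
  then have \<theta>_ge: "y i \<le> \<theta>" if "i \<in> {1..n} - T" for i using T(1) that by (auto simp: is_top_def)
  have "sum x T' - j * \<theta> = (\<Sum>i\<in>T'. x i - \<theta>)" using T'(2) by (simp add: sum_subtractf)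
  also have "\<dots> \<le> (\<Sum>i\<in>T'. max 0 (x i - \<theta>))" by (intro sum_mono) auto
  also have "\<dots> \<le> (\<Sum>i\<in>{1..n}. max 0 (x i - \<theta>))" using sub by (intro sum_mono2) auto
  also have "\<dots> = (\<Sum>i\<in>U. x i - \<theta>)"
    unfolding U_def by (subst sum.inter_filter) (auto intro!: sum.cong)
  also have "\<dots> \<le> (\<Sum>i\<in>U. y i - \<theta>)" using level[of \<theta>] by (simp add: U_def sum_subtractf)
  also have "\<dots> \<le> (\<Sum>i\<in>U. max 0 (y i - \<theta>))" by (intro sum_mono) auto
  also have "\<dots> \<le> (\<Sum>i\<in>{1..n}. max 0 (y i - \<theta>))" by (intro sum_mono2) (auto simp: U_def)
  also have "\<dots> = (\<Sum>i\<in>T. max 0 (y i - \<theta>))"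
    using sub \<theta>_ge by (intro sum.mono_neutral_right) auto
  also have "\<dots> = (\<Sum>i\<in>T. y i - \<theta>)" using \<theta>_le by (intro sum.cong) auto
  also have "\<dots> = sum y T - j * \<theta>" using T(2) by (simp add: sum_subtractf)
  finally show "sum_largest n j x \<le> sum_largest n j y" using T(3) T'(3) by simp
qed

text \<open>Equal prefix sums force equal sorted lists, and the sum of squares depends only on the
  sorted list. Combined with uniqueness of the least-squares load, this identifies
  majorization-minimal elements.\<close>

lemma majorizes_antisym_sum_squares:
  assumes "majorizes n x y" "majorizes n y x"
  shows "(\<Sum>i\<in>{1..n}. (x i)\<^sup>2) = (\<Sum>i\<in>{1..n}. (y i)\<^sup>2)"
proof -
  define L where "L z = rev (sort (map z [1..<Suc n]))" for z :: alloc
  have len: "length (L z) = n" for z by (simp add: L_def)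
  have pre: "sum_list (take j (L x)) = sum_list (take j (L y))" if "j \<le> n" for j
    using assms that unfolding majorizes_def sum_largest_def L_def
    by (cases "j = 0") (force intro: antisym)+
  have "L x = L y"
  proof (rule nth_equalityI)
    show "length (L x) = length (L y)" by (simp add: len)
    fix k assume "k < length (L x)"
    then have k: "k < n" by (simp add: len)
    then show "L x ! k = L y ! k"
      using pre[of k] pre[of "Suc k"] by (simp add: take_Suc_conv_app_nth len)
  qed
  moreover have "(\<Sum>i\<in>{1..n}. (z i)\<^sup>2) = (\<Sum>v\<in>#mset (L z). v\<^sup>2)" for z
  proof -
    have "mset (L z) = image_mset z (mset_set {1..n})"
      using mset_upt[of 1 "Suc n"]
      by (simp add: L_def atLeastLessThanSuc_atLeastAtMost del: upt_Suc mset_upt)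
    then show ?thesis by (simp add: sum_unfold_sum_mset image_mset.compositionality o_def)
  qed
  ultimately show ?thesis by simp
qed

subsection \<open>The optimal load\<close>

lemma total_nth: "total xs i = (\<Sum>t<length xs. (xs ! t) i)"
  by (simp add: total_def sum_list_sum_nth atLeast0LessThan)

lemma sum_total: "sum (total xs) U = (\<Sum>t<length xs. sum (xs ! t) U)"
  unfolding total_nth by (rule sum.swap)

lemma Delta_sum_superset:
  assumes "x \<in> Delta n e" "is_request n e" "fst e \<subseteq> U" "finite U"
  shows "sum x U = snd e"
proof -
  have "finite (fst e)" using assms(2) finite_subset by (auto simp: is_request_def)
  have "sum x U = sum x (fst e)"
    using assms by (intro sum.mono_neutral_right) (auto simp: Delta_def)
  also have "\<dots> = sum x {1..n}"
    using assms by (intro sum.mono_neutral_left) (auto simp: Delta_def is_request_def)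
  finally show ?thesis using assms(1) by (simp add: Delta_def)
qed

lemma Delta_sum_le:
  assumes "x \<in> Delta n e" "U \<subseteq> {1..n}"
  shows "sum x U \<le> snd e"
  using assms sum_mono2[of "{1..n}" U x] by (auto simp: Delta_def)

lemma Delta_nonempty:
  assumes "is_request n e"
  shows "Delta n e \<noteq> {}"
proof -
  obtain i where "i \<in> fst e" "i \<in> {1..n}" using assms unfolding is_request_def by blast
  then have "(\<lambda>l. if l = i then snd e else 0) \<in> Delta n e"
    using assms by (auto simp: Delta_def is_request_def)
  then show ?thesis by blast
qed

lemma compact_Delta:
  assumes "is_request n e"
  shows "compact (Delta n e)"
proof -
  \<comment> \<open>A product of compact intervals with factor \<open>{0}\<close> off the
    neighbourhood, compact by Tychonoff; \<open>Delta\<close> is its intersection with a closed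
    hyperplane.\<close>
  define B where "B = PiE UNIV (\<lambda>i. if i \<in> fst e then {0..snd e} else {0})"
  have "closed {x::alloc. (\<Sum>i\<in>{1..n}. x i) = snd e}"
    by (intro closed_Collect_eq continuous_on_sum continuous_on_product_coordinates
        continuous_on_const)
  moreover have "compactin (product_topology (\<lambda>i. euclidean) UNIV) B"
    unfolding B_def compactin_PiE by auto
  then have "compact B" unfolding euclidean_product_topology by simp
  ultimately have "compact (B \<inter> {x. (\<Sum>i\<in>{1..n}. x i) = snd e})"
    by (intro compact_Int_closed)
  moreover have "Delta n e = B \<inter> {x. (\<Sum>i\<in>{1..n}. x i) = snd e}"
  proof (intro equalityI subsetI)
    fix x assume x: "x \<in> Delta n e"
    have "x i \<le> snd e" if "i \<in> fst e" for i
      using Delta_sum_le[OF x, of "{i}"] that assms by (auto simp: is_request_def)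
    then show "x \<in> B \<inter> {x. (\<Sum>i\<in>{1..n}. x i) = snd e}"
      using x by (auto simp: Delta_def B_def)
  next
    fix x assume x: "x \<in> B \<inter> {x. (\<Sum>i\<in>{1..n}. x i) = snd e}"
    then have "x i \<in> (if i \<in> fst e then {0..snd e} else {0})" for i
      unfolding B_def PiE_iff by blast
    then have "0 \<le> x i" "i \<notin> fst e \<longrightarrow> x i = 0" for i by (smt (verit) atLeastAtMost_iff singletonD)+
    then show "x \<in> Delta n e" using x by (auto simp: Delta_def)
  qed
  ultimately show ?thesis by simp
qed

lemma Delta_seq_Nil: "Delta_seq n [] = {\<lambda>_. 0}"
  by (auto simp: Delta_seq_def total_def)

text \<open>The Minkowski sum in recursive form, so that compactness, nonemptiness and closure under
  midpoints pass from \<open>Delta\<close> to \<open>Delta_seq\<close> by induction.\<close>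

lemma Delta_seq_Cons:
  "Delta_seq n (e # E) = (\<lambda>(x, y) i. x i + y i) ` (Delta n e \<times> Delta_seq n E)"
proof (intro equalityI subsetI)
  fix z assume "z \<in> Delta_seq n (e # E)"
  then obtain x xs where "z = total (x # xs)" "x \<in> Delta n e" "list_all2 (\<lambda>x e. x \<in> Delta n e) xs E"
    by (auto simp: Delta_seq_def list_all2_Cons2)
  then show "z \<in> (\<lambda>(x, y) i. x i + y i) ` (Delta n e \<times> Delta_seq n E)"
    by (auto simp: Delta_seq_def total_def intro!: image_eqI[of _ _ "(x, total xs)"])
next
  fix z assume "z \<in> (\<lambda>(x, y) i. x i + y i) ` (Delta n e \<times> Delta_seq n E)"
  then obtain x xs where "z = (\<lambda>i. x i + total xs i)" "x \<in> Delta n e"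
    "list_all2 (\<lambda>x e. x \<in> Delta n e) xs E"
    by (auto simp: Delta_seq_def)
  then show "z \<in> Delta_seq n (e # E)"
    by (auto simp: Delta_seq_def total_def intro!: exI[of _ "x # xs"])
qed

lemma compact_Delta_seq:
  assumes "\<forall>e\<in>set E. is_request n e"
  shows "compact (Delta_seq n E)"
  using assms
proof (induction E)
  case Nil
  then show ?case by (simp add: Delta_seq_Nil)
next
  case (Cons e E)
  have "continuous_on UNIV (\<lambda>(x::alloc, y::alloc) i. x i + y i)"
    unfolding case_prod_unfold
    by (intro continuous_on_coordinatewise_then_product continuous_on_add
        continuous_on_product_then_coordinatewise[OF continuous_on_fst[OF continuous_on_id]]
        continuous_on_product_then_coordinatewise[OF continuous_on_snd[OF continuous_on_id]])
  then show ?case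
    using Cons unfolding Delta_seq_Cons
    by (intro compact_continuous_image compact_Times compact_Delta)
      (auto intro: continuous_on_subset)
qed

lemma Delta_seq_nonempty:
  assumes "\<forall>e\<in>set E. is_request n e"
  shows "Delta_seq n E \<noteq> {}"
  using assms by (induction E) (auto simp: Delta_seq_Nil Delta_seq_Cons Delta_nonempty)

lemma Delta_midpoint:
  "x \<in> Delta n e \<Longrightarrow> y \<in> Delta n e \<Longrightarrow> (\<lambda>i. (x i + y i) / 2) \<in> Delta n e"
  by (auto simp: Delta_def sum.distrib simp flip: sum_divide_distrib)

lemma Delta_seq_midpoint:
  "x \<in> Delta_seq n E \<Longrightarrow> y \<in> Delta_seq n E \<Longrightarrow> (\<lambda>i. (x i + y i) / 2) \<in> Delta_seq n E"
proof (induction E arbitrary: x y)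
  case Nil
  then show ?case by (simp add: Delta_seq_Nil)
next
  case (Cons e E)
  obtain x1 x2 y1 y2 where "x = (\<lambda>i. x1 i + x2 i)" "y = (\<lambda>i. y1 i + y2 i)"
    "x1 \<in> Delta n e" "y1 \<in> Delta n e" "x2 \<in> Delta_seq n E" "y2 \<in> Delta_seq n E"
    using Cons.prems unfolding Delta_seq_Cons by auto
  then show ?case
    using Cons.IH[of x2 y2] Delta_midpoint[of x1 n e y1] unfolding Delta_seq_Cons
    by (intro image_eqI[of _ _ "(\<lambda>i. (x1 i + y1 i) / 2, \<lambda>i. (x2 i + y2 i) / 2)"])
      (auto simp: field_simps)
qed

lemma Delta_seq_outside:
  assumes "\<forall>e\<in>set E. is_request n e" "x \<in> Delta_seq n E" "i \<notin> {1..n}"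
  shows "x i = 0"
  using assms
proof (induction E arbitrary: x)
  case (Cons e E)
  then show ?case by (fastforce simp: Delta_seq_Cons Delta_def is_request_def)
qed (simp add: Delta_seq_Nil)

lemma Delta_seq_total:
  assumes "x \<in> Delta_seq n E"
  shows "sum x {1..n} = (\<Sum>e\<leftarrow>E. snd e)"
  using assms
  by (induction E arbitrary: x) (auto simp: Delta_seq_Nil Delta_seq_Cons Delta_def sum.distrib)

section \<open>The feasible load with the least sum of squares\<close>

definition sum_squares :: "nat \<Rightarrow> alloc \<Rightarrow> real" where
  "sum_squares n x = (\<Sum>i\<in>{1..n}. (x i)\<^sup>2)"

lemma sum_squares_minimizer_exists:
  assumes "\<forall>e\<in>set E. is_request n e"
  obtains x where "x \<in> Delta_seq n E" "\<And>y. y \<in> Delta_seq n E \<Longrightarrow> sum_squares n x \<le> sum_squares n y"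
proof -
  have "continuous_on UNIV (sum_squares n)"
    unfolding sum_squares_def
    by (intro continuous_intros continuous_on_product_coordinates)
  then show ?thesis
    using continuous_attains_inf[OF compact_Delta_seq Delta_seq_nonempty, OF assms assms]
      continuous_on_subset[of UNIV] that by blast
qed

text \<open>Strict convexity in the form of the parallelogram identity: the midpoint of two distinct
  minimizers would be feasible and have a smaller sum of squares.\<close>

lemma sum_squares_minimizer_unique:
  assumes E: "\<forall>e\<in>set E. is_request n e"
    and x: "x \<in> Delta_seq n E" "\<And>y. y \<in> Delta_seq n E \<Longrightarrow> sum_squares n x \<le> sum_squares n y"
    and y: "y \<in> Delta_seq n E" "sum_squares n y = sum_squares n x"
  shows "y = x"
proof
  fix i
  have eq: "(x i - y i)\<^sup>2 / 2 = (x i)\<^sup>2 + (y i)\<^sup>2 - 2 * ((x i + y i) / 2)\<^sup>2" for i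
    by (simp add: power2_eq_square field_simps)
  have "sum_squares n x + sum_squares n y - 2 * sum_squares n (\<lambda>i. (x i + y i) / 2)
      = (\<Sum>i\<in>{1..n}. (x i - y i)\<^sup>2 / 2)"
    by (simp only: eq sum_squares_def sum_distrib_left sum.distrib sum_subtractf)
  moreover have "sum_squares n x \<le> sum_squares n (\<lambda>i. (x i + y i) / 2)"
    using x y Delta_seq_midpoint by blast
  ultimately have "(\<Sum>i\<in>{1..n}. (x i - y i)\<^sup>2 / 2) \<le> 0" using y by simp
  then have "(\<Sum>i\<in>{1..n}. (x i - y i)\<^sup>2 / 2) = 0" by (intro antisym sum_nonneg) auto
  \<comment> \<open>\<open>sum_squares\<close> sees only the coordinates in \<open>{1..n}\<close>;
    elsewhere both loads vanish.\<close>
  then show "y i = x i"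
    using Delta_seq_outside[OF E x(1)] Delta_seq_outside[OF E y(1)]
    by (cases "i \<in> {1..n}") (auto simp: sum_nonneg_eq_0_iff)
qed

lemma sum_squares_transfer:
  assumes "i \<in> {1..n}" "k \<in> {1..n}" "i \<noteq> k"
  shows "sum_squares n (x(i := x i - \<epsilon>, k := x k + \<epsilon>))
    = sum_squares n x - 2 * \<epsilon> * (x i - x k - \<epsilon>)"
proof -
  have "sum_squares n z = (z i)\<^sup>2 + ((z k)\<^sup>2 + (\<Sum>l\<in>{1..n} - {i} - {k}. (z l)\<^sup>2))" for z
    using assms sum.remove[of "{1..n}" i "\<lambda>l. (z l)\<^sup>2"]
      sum.remove[of "{1..n} - {i}" k "\<lambda>l. (z l)\<^sup>2"] by (simp add: sum_squares_def)
  moreover have "(\<Sum>l\<in>{1..n} - {i} - {k}. ((x(i := x i - \<epsilon>, k := x k + \<epsilon>)) l)\<^sup>2)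
      = (\<Sum>l\<in>{1..n} - {i} - {k}. (x l)\<^sup>2)"
    by (intro sum.cong) auto
  ultimately show ?thesis using assms by (simp add: power2_eq_square algebra_simps)
qed

lemma Delta_transfer:
  assumes "x \<in> Delta n e" "is_request n e" "i \<in> fst e" "k \<in> fst e" "i \<noteq> k" "0 \<le> \<epsilon>" "\<epsilon> \<le> x i"
  shows "x(i := x i - \<epsilon>, k := x k + \<epsilon>) \<in> Delta n e"
proof -
  have ik: "i \<in> {1..n}" "k \<in> {1..n}" using assms by (auto simp: is_request_def)
  have "sum z {1..n} = z i + (z k + sum z ({1..n} - {i} - {k}))" for z :: alloc
    using ik assms(5) sum.remove[of "{1..n}" i z] sum.remove[of "{1..n} - {i}" k z] by simp
  moreover have "sum (x(i := x i - \<epsilon>, k := x k + \<epsilon>)) ({1..n} - {i} - {k})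
      = sum x ({1..n} - {i} - {k})"
    by (intro sum.cong) auto
  ultimately have "sum (x(i := x i - \<epsilon>, k := x k + \<epsilon>)) {1..n} = sum x {1..n}"
    using assms(5) by simp
  then show ?thesis using assms by (auto simp: Delta_def)
qed

lemma total_update:
  assumes "t < length xs"
  shows "total (xs[t := z]) i = total xs i - (xs ! t) i + z i"
proof -
  have "total ys i = (ys ! t) i + (\<Sum>s\<in>{..<length ys} - {t}. (ys ! s) i)" if "t < length ys" for ys
    using that by (simp add: total_nth sum.remove)
  from this[of xs] this[of "xs[t := z]"] assms show ?thesis
    by (auto intro!: sum.cong)
qed

text \<open>Exchange argument: if \<open>i\<close> were loaded more than \<open>k\<close>, shifting
  a little of request \<open>t\<close> from \<open>i\<close> to \<open>k\<close> would stay feasible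
  and decrease the sum of squares.\<close>

lemma sum_squares_minimizer_local:
  assumes E: "\<forall>e\<in>set E. is_request n e"
    and xs: "list_all2 (\<lambda>x e. x \<in> Delta n e) xs E"
    and min: "\<And>y. y \<in> Delta_seq n E \<Longrightarrow> sum_squares n (total xs) \<le> sum_squares n y"
    and t: "t < length E" "i \<in> fst (E ! t)" "k \<in> fst (E ! t)" "(xs ! t) i > 0"
  shows "total xs i \<le> total xs k"
proof (rule ccontr)
  assume contra: "\<not> total xs i \<le> total xs k"
  \<comment> \<open>The first bound keeps the allocation nonnegative; half the gap makes the change
    computed in \<open>sum_squares_transfer\<close> strictly negative.\<close>
  define \<epsilon> where "\<epsilon> = min ((xs ! t) i) ((total xs i - total xs k) / 2)"
  have \<epsilon>: "0 < \<epsilon>" "\<epsilon> \<le> (xs ! t) i" "\<epsilon> < total xs i - total xs k"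
    using contra t by (auto simp: \<epsilon>_def min_def)
  have len: "length xs = length E" using xs by (rule list_all2_lengthD)
  have "fst (E ! t) \<subseteq> {1..n}"
    using E nth_mem[OF t(1)] by (simp add: is_request_def)
  then have ik: "i \<in> {1..n}" "k \<in> {1..n}" "i \<noteq> k"
    using t contra by auto
  let ?z = "(xs ! t)(i := (xs ! t) i - \<epsilon>, k := (xs ! t) k + \<epsilon>)"
  have "?z \<in> Delta n (E ! t)"
    using xs t E ik \<epsilon> by (intro Delta_transfer) (auto simp: list_all2_conv_all_nth)
  then have "list_all2 (\<lambda>x e. x \<in> Delta n e) (xs[t := ?z]) E"
    using xs t by (auto simp: list_all2_conv_all_nth nth_list_update)
  then have "sum_squares n (total xs) \<le> sum_squares n (total (xs[t := ?z]))"
    using min by (auto simp: Delta_seq_def)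
  moreover have "total (xs[t := ?z]) = (total xs)(i := total xs i - \<epsilon>, k := total xs k + \<epsilon>)"
    using t len ik by (auto simp: total_update)
  ultimately have "2 * \<epsilon> * (total xs i - total xs k - \<epsilon>) \<le> 0"
    using sum_squares_transfer[OF ik] by simp
  then show False using \<epsilon> by (simp add: mult_le_0_iff)
qed

text \<open>On an upper level set \<open>U\<close> of the minimizer, the load consists exactly of the requests whose
  neighbourhood lies inside \<open>U\<close>, and every other allocation has to place those in \<open>U\<close> as well.\<close>

lemma sum_squares_minimizer_least:
  assumes E: "\<forall>e\<in>set E. is_request n e"
    and x: "x \<in> Delta_seq n E" "\<And>y. y \<in> Delta_seq n E \<Longrightarrow> sum_squares n x \<le> sum_squares n y"
    and y: "y \<in> Delta_seq n E"
  shows "majorizes n y x"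
proof (rule majorizes_level_sets)
  show "sum x {1..n} = sum y {1..n}" 
    using Delta_seq_total[OF x(1)] Delta_seq_total[OF y] by simp
  fix \<theta>
  define U where "U = {i\<in>{1..n}. \<theta> < x i}"
  obtain xs where xs: "x = total xs" "list_all2 (\<lambda>x e. x \<in> Delta n e) xs E"
    using x by (auto simp: Delta_seq_def)
  obtain ys where ys: "y = total ys" "list_all2 (\<lambda>x e. x \<in> Delta n e) ys E"
    using y by (auto simp: Delta_seq_def)
  have "sum (xs ! t) U \<le> sum (ys ! t) U" if t: "t < length E" for t
  proof -
    have e: "is_request n (E ! t)" and x_t: "xs ! t \<in> Delta n (E ! t)" and y_t: "ys ! t \<in> Delta n (E ! t)"
      using t E xs ys by (auto simp: list_all2_conv_all_nth)
    show ?thesis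
    proof (cases "fst (E ! t) \<subseteq> U")
      case True
      then show ?thesis
        using Delta_sum_superset[OF x_t e] Delta_sum_superset[OF y_t e] by (simp add: U_def)
    next
      case False
      then obtain k where k: "k \<in> fst (E ! t)" "k \<notin> U" by auto
      then have k_le: "x k \<le> \<theta>" using e by (auto simp: U_def is_request_def)
      have "(xs ! t) i = 0" if "i \<in> U" for i
      proof (rule ccontr)
        assume "(xs ! t) i \<noteq> 0"
        then have i: "i \<in> fst (E ! t)" "(xs ! t) i > 0"
          using x_t unfolding Delta_def by (auto simp: order_less_le)
        have "x i \<le> x k"
          using sum_squares_minimizer_local[OF E xs(2) _ t i(1) k(1) i(2)] x(2) xs(1) by simp
        then show False using \<open>i \<in> U\<close> k_le by (simp add: U_def)
      qed
      then have "sum (xs ! t) U = 0" by simp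
      also have "0 \<le> sum (ys ! t) U" using y_t by (intro sum_nonneg) (auto simp: Delta_def)
      finally show ?thesis .
    qed
  qed
  then have "sum x U \<le> sum y U"
    using xs ys by (auto simp: sum_total list_all2_conv_all_nth intro: sum_mono)
  then show "sum x {i\<in>{1..n}. \<theta> < x i} \<le> sum y {i\<in>{1..n}. \<theta> < x i}" by (simp add: U_def)
qed

text \<open>Resolves the definite description: the least-squares load is majorized by every feasible
  load. A minimal element is then equivalent to it under majorization, has the same sum of squares,
  and so coincides with it.\<close>

lemma OPT_least:
  assumes E: "\<forall>e\<in>set E. is_request n e"
  shows "OPT n E \<in> Delta_seq n E"
    and "y \<in> Delta_seq n E \<Longrightarrow> majorizes n y (OPT n E)"
proof -
  obtain x where x: "x \<in> Delta_seq n E" "\<And>y. y \<in> Delta_seq n E \<Longrightarrow> sum_squares n x \<le> sum_squares n y"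
    using sum_squares_minimizer_exists[OF E] by blast
  have least: "majorizes n y x" if "y \<in> Delta_seq n E" for y
    using sum_squares_minimizer_least[OF E x that] by blast
  have "OPT n E = x"
    unfolding OPT_def
  proof (rule the_equality)
    show "majorization_minimal n (Delta_seq n E) x"
      using x least by (simp add: majorization_minimal_def)
    fix y assume y: "majorization_minimal n (Delta_seq n E) y"
    then have "majorizes n x y" "majorizes n y x" "y \<in> Delta_seq n E"
      using x least by (auto simp: majorization_minimal_def)
    then show "y = x"
      using sum_squares_minimizer_unique[OF E x] majorizes_antisym_sum_squares
      by (metis sum_squares_def)
  qed
  then show "OPT n E \<in> Delta_seq n E"
    and "y \<in> Delta_seq n E \<Longrightarrow> majorizes n y (OPT n E)"
    using x least by auto
qed

subsection \<open>Water-filling\<close>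

lemma water_level_exists:
  fixes a :: "'a \<Rightarrow> real"
  assumes "finite N" "N \<noteq> {}" "q \<ge> 0"
  obtains \<mu> where "(\<Sum>i\<in>N. max 0 (\<mu> - a i)) = q"
proof -
  define f where "f \<mu> = (\<Sum>i\<in>N. max 0 (\<mu> - a i))" for \<mu>
  obtain k where k: "k \<in> N" using assms by auto
  define lo where "lo = Min (a ` N)"
  \<comment> \<open>At this level the node \<open>k\<close> alone absorbs at least \<open>q\<close>,
    while at \<open>lo\<close> nothing is absorbed; the intermediate value theorem gives the level
    in between.\<close>
  define hi where "hi = max lo (a k + q)"
  have "lo \<le> a i" if "i \<in> N" for i using that assms by (simp add: lo_def)
  then have "f lo = 0" unfolding f_def by (intro sum.neutral) auto
  have "q \<le> max 0 (hi - a k)" by (simp add: hi_def)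
  also have "\<dots> \<le> f hi"
    unfolding f_def using assms k by (intro member_le_sum) auto
  finally have "q \<le> f hi" .
  have "\<exists>\<mu>\<ge>lo. \<mu> \<le> hi \<and> f \<mu> = q"
    using \<open>f lo = 0\<close> \<open>q \<le> f hi\<close> assms(3)
    by (intro IVT') (auto simp: hi_def f_def intro!: continuous_intros)
  then show ?thesis using that by (auto simp: f_def)
qed

lemma water_filling_level:
  assumes e: "is_request n e"
  obtains \<mu> where "water_filling n (es @ [e]) xs
      = (\<lambda>i. if i \<in> fst e then max 0 (\<mu> - total xs i) else 0)"
    and "water_filling n (es @ [e]) xs \<in> Delta n e"
proof -
  define N where "N = fst e"
  have N: "finite N" "N \<noteq> {}" "N \<subseteq> {1..n}" "snd e > 0"
    using e finite_subset by (auto simp: is_request_def N_def)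
  obtain \<mu> where \<mu>: "(\<Sum>i\<in>N. max 0 (\<mu> - total xs i)) = snd e"
    using water_level_exists[of N "snd e" "total xs"] N by auto
  define x where "x = (\<lambda>i. if i \<in> N then max 0 (\<mu> - total xs i) else 0)"
  have sum_N: "sum y {1..n} = sum y N" if "\<And>i. i \<notin> N \<Longrightarrow> y i = 0" for y :: alloc
    using N that by (intro sum.mono_neutral_right) auto
  have "sum x N = snd e" using \<mu> by (simp add: x_def)
  then have x: "x \<in> Delta n e" using sum_N[of x] by (auto simp: Delta_def x_def N_def)
  define f where "f y = Min ((\<lambda>i. y i + total xs i) ` N)" for y :: alloc
  have f_ge: "c \<le> f y \<longleftrightarrow> (\<forall>i\<in>N. c \<le> y i + total xs i)" for c y
    using N by (auto simp: f_def)
  have "\<mu> \<le> f x" by (auto simp: f_ge x_def)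
  \<comment> \<open>Minimum at least \<open>\<mu>\<close> together with nonnegativity forces
    \<open>y\<close> to dominate \<open>x\<close> at every node of \<open>N\<close>, and equal
    totals leave no room for strict excess.\<close>
  have unique: "y = x" if y: "y \<in> Delta n e" "\<mu> \<le> f y" for y
  proof -
    have ge: "x i \<le> y i" if "i \<in> N" for i
      using y that by (auto simp: f_ge x_def Delta_def)
    have "sum y N = snd e" using y sum_N[of y] by (auto simp: Delta_def N_def)
    then have "(\<Sum>i\<in>N. y i - x i) = 0" using \<open>sum x N = snd e\<close> by (simp add: sum_subtractf)
    then have "\<forall>i\<in>N. y i - x i = 0" using ge N by (subst (asm) sum_nonneg_eq_0_iff) auto
    then show ?thesis using y by (auto simp: x_def Delta_def N_def fun_eq_iff)
  qed
  have "water_filling n (es @ [e]) xs = (THE x. is_arg_max f (\<lambda>x. x \<in> Delta n e) x)"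
    by (simp add: water_filling_def f_def[abs_def] N_def)
  also have "\<dots> = x"
  proof (rule the_equality)
    show "is_arg_max f (\<lambda>x. x \<in> Delta n e) x"
      using x unique \<open>\<mu> \<le> f x\<close> unfolding is_arg_max_def
      by (metis linorder_not_less order.irrefl order.strict_trans1 order_less_imp_le)
    fix y assume "is_arg_max f (\<lambda>x. x \<in> Delta n e) y"
    then have "y \<in> Delta n e" "f x \<le> f y" using x by (auto simp: is_arg_max_def not_less)
    then show "y = x" using unique \<open>\<mu> \<le> f x\<close> by auto
  qed
  finally have "water_filling n (es @ [e]) xs = x" .
  then show ?thesis using that[of \<mu>] x by (simp add: x_def N_def)
qed

lemma run_lengths: "length (fst (run P F t)) = t" "length (snd (run P F t)) = t"
  by (induction t) (auto simp: case_prod_unfold Let_def)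

lemma run_Suc:
  "fst (run P F (Suc t)) = fst (run P F t) @ [F (fst (run P F t)) (snd (run P F t))]"
  "snd (run P F (Suc t)) = snd (run P F t) @ [P (fst (run P F (Suc t))) (snd (run P F t))]"
  by (simp_all add: case_prod_unfold Let_def)

lemma run_oblivious: "t \<le> length E \<Longrightarrow> fst (run P (oblivious E) t) = take t E"
  by (induction t) (simp_all add: run_Suc run_lengths oblivious_def take_Suc_conv_app_nth del: run.simps(2))

lemma total_snoc: "total (xs @ [x]) i = total xs i + x i"
  by (simp add: total_def)

lemma total_run:
  "total (snd (run P F t)) i = (\<Sum>s<t. P (fst (run P F (Suc s))) (snd (run P F s)) i)"
  by (induction t) (simp_all add: run_Suc total_snoc total_def[of "[]"] del: run.simps(2))

text \<open>All that later arguments use about water-filling: after a round, every offered node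
  reaches at least the level of that round, and a node that received water is exactly at it.\<close>

lemma WF_levels:
  assumes E: "\<forall>e\<in>set E. is_request n e"
  obtains x :: "nat \<Rightarrow> alloc" and \<mu> :: "nat \<Rightarrow> real"
  where "WF n E = (\<lambda>i. \<Sum>t<length E. x t i)"
    and "\<And>t. t < length E \<Longrightarrow> x t \<in> Delta n (E ! t)"
    and "\<And>t i. t < length E \<Longrightarrow> i \<in> fst (E ! t) \<Longrightarrow> \<mu> t \<le> (\<Sum>s<Suc t. x s i)"
    and "\<And>t i. t < length E \<Longrightarrow> 0 < x t i \<Longrightarrow> (\<Sum>s<Suc t. x s i) = \<mu> t"
proof -
  let ?r = "run (water_filling n) (oblivious E)"
  define x where "x t = water_filling n (fst (?r (Suc t))) (snd (?r t))" for t
  have load: "total (snd (?r t)) = (\<lambda>i. \<Sum>s<t. x s i)" for t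
    by (rule ext) (simp add: total_run x_def del: run.simps(2))
  have "\<exists>\<mu>. x t = (\<lambda>i. if i \<in> fst (E ! t) then max 0 (\<mu> - (\<Sum>s<t. x s i)) else 0) \<and> x t \<in> Delta n (E ! t)"
    if t: "t < length E" for t
  proof -
    have "is_request n (E ! t)" using E t by auto
    then obtain \<mu> where "water_filling n (take t E @ [E ! t]) (snd (?r t))
      = (\<lambda>i. if i \<in> fst (E ! t) then max 0 (\<mu> - total (snd (?r t)) i) else 0)"
      "water_filling n (take t E @ [E ! t]) (snd (?r t)) \<in> Delta n (E ! t)"
      by (rule water_filling_level)
    moreover have "fst (?r (Suc t)) = take t E @ [E ! t]"
      using t run_oblivious[of "Suc t" E] by (simp add: take_Suc_conv_app_nth del: run.simps(2))
    ultimately show ?thesis unfolding load x_def[symmetric]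
      by (metis x_def)
  qed
  then obtain \<mu> where \<mu>: "\<And>t. t < length E \<Longrightarrow>
      x t = (\<lambda>i. if i \<in> fst (E ! t) then max 0 (\<mu> t - (\<Sum>s<t. x s i)) else 0)"
    and D: "\<And>t. t < length E \<Longrightarrow> x t \<in> Delta n (E ! t)"
    by metis
  show ?thesis
  proof (rule that[of x \<mu>])
    show "WF n E = (\<lambda>i. \<Sum>t<length E. x t i)"
      by (simp add: WF_def final_alloc_def load)
    fix t i assume t: "t < length E"
    show "x t \<in> Delta n (E ! t)" using D t .
    note eq = fun_cong[OF \<mu>[OF t], of i]
    show "\<mu> t \<le> (\<Sum>s<Suc t. x s i)" if "i \<in> fst (E ! t)" using eq that by simp
    show "(\<Sum>s<Suc t. x s i) = \<mu> t" if "0 < x t i" using eq that by (auto split: if_splits)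
  qed
qed

section \<open>Weighing water by its height\<close>

lemma integrable_antimono:
  fixes h :: "real \<Rightarrow> real"
  assumes "antimono h"
  shows "h integrable_on {a..b}"
proof -
  have "mono_on {a..b} (\<lambda>x. - h x)" using assms by (auto simp: mono_on_def dest: antimonoD)
  from integrable_on_mono_on[OF this] show ?thesis by (simp add: integrable_neg_iff)
qed

text \<open>On \<open>{a..b}\<close> an antitone weight is at least its value at the upper end; this
  is applied to a round that raises a node from height \<open>a\<close> to \<open>b\<close>.\<close>

lemma integral_antimono_increment:
  fixes h :: "real \<Rightarrow> real"
  assumes "antimono h" "0 \<le> a" "a \<le> b"
  shows "(b - a) * h b \<le> integral {0..b} h - integral {0..a} h"
proof -
  have "integral {a..b} (\<lambda>_. h b) \<le> integral {a..b} h"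
    using assms integrable_antimono by (intro integral_le) (auto dest: antimonoD)
  moreover have "integral {0..a} h + integral {a..b} h = integral {0..b} h"
    using assms integrable_antimono by (intro Henstock_Kurzweil_Integration.integral_combine) auto
  ultimately show ?thesis using assms by simp
qed

text \<open>For a top set \<open>T\<close> of the loads \<open>w\<close>, the fraction of the nodes with load at least \<open>\<theta>\<close> that
  lie outside \<open>T\<close>.\<close>

definition low_fraction :: "nat \<Rightarrow> alloc \<Rightarrow> nat \<Rightarrow> real \<Rightarrow> real" where
  "low_fraction n w j \<theta> = (let g = card {i\<in>{1..n}. \<theta> \<le> w i} in max 0 (real g - j) / g)"

text \<open>With \<open>g\<close> nodes at height \<open>\<theta>\<close> or above, the value is the
  positive part of \<open>1 - j / g\<close>, which shrinks with \<open>g\<close>; for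
  \<open>g = 0\<close> division by zero yields 0.\<close>

lemma antimono_low_fraction: "antimono (low_fraction n w j)"
proof (rule antimonoI)
  fix \<theta> \<theta>' :: real assume le: "\<theta> \<le> \<theta>'"
  define g where "g = card {i\<in>{1..n}. \<theta> \<le> w i}"
  define g' where "g' = card {i\<in>{1..n}. \<theta>' \<le> w i}"
  have "g' \<le> g" unfolding g_def g'_def using le by (intro card_mono) auto
  have "max 0 (real g' - j) / g' \<le> max 0 (real g - j) / g"
  proof (cases "g' \<le> j")
    case False
    then have "real j * g' \<le> real j * g" using \<open>g' \<le> g\<close> by (intro mult_left_mono) auto
    then show ?thesis using False \<open>g' \<le> g\<close> by (simp add: field_simps)
  qed simp
  then show "low_fraction n w j \<theta>' \<le> low_fraction n w j \<theta>"
    by (simp add: low_fraction_def g_def g'_def Let_def)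
qed

text \<open>A level set \<open>U\<close> and a top set \<open>T\<close> are comparable by inclusion,
  so \<open>U - T\<close> has \<open>max 0 (card U - card T)\<close> elements. Giving each node of
  \<open>U\<close> the fraction outside \<open>T\<close> therefore counts
  \<open>U - T\<close>.\<close>

lemma sum_indicator_level_set:
  assumes T: "is_top w T {1..n}"
  shows "(\<Sum>i\<in>{1..n}. if \<theta> \<le> w i then low_fraction n w (card T) \<theta> else 0)
    = (\<Sum>i\<in>{1..n} - T. if \<theta> \<le> w i then 1 else 0)"
proof -
  define U where "U = {i\<in>{1..n}. \<theta> \<le> w i}"
  have fin: "finite U" "finite T" using T finite_subset by (auto simp: U_def is_top_def)
  have card: "real (card (U - T)) = max 0 (real (card U) - card T)"
  proof (cases "U \<subseteq> T")
    case True
    then have "card U \<le> card T" using fin by (auto intro: card_mono)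
    moreover have "U - T = {}" using True by blast
    then have "card (U - T) = 0" by (simp only: card.empty)
    ultimately show ?thesis by simp
  next
    case False
    then obtain b where b: "b \<in> {1..n} - T" "\<theta> \<le> w b" by (auto simp: U_def)
    have "w b \<le> w i" "i \<in> {1..n}" if "i \<in> T" for i
      using T b(1) that unfolding is_top_def by blast+
    then have "T \<subseteq> U" using b(2) by (force simp: U_def)
    then show ?thesis using fin by (simp add: card_Diff_subset card_mono of_nat_diff)
  qed
  have "(\<Sum>i\<in>{1..n}. if \<theta> \<le> w i then low_fraction n w (card T) \<theta> else 0)
      = (\<Sum>i\<in>U. low_fraction n w (card T) \<theta>)"
    unfolding U_def by (rule sum.inter_filter[symmetric]) simp
  also have "\<dots> = max 0 (real (card U) - card T)"
  proof -
    have "low_fraction n w (card T) \<theta> = max 0 (real (card U) - card T) / card U"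
      by (simp add: low_fraction_def U_def Let_def)
    then show ?thesis by (cases "card U = 0") auto
  qed
  also have "\<dots> = (\<Sum>i\<in>{i\<in>{1..n} - T. \<theta> \<le> w i}. 1)"
    unfolding card[symmetric] by (auto simp: U_def intro!: arg_cong[of _ _ card])
  also have "\<dots> = (\<Sum>i\<in>{1..n} - T. if \<theta> \<le> w i then 1 else 0)"
    by (rule sum.inter_filter) simp
  finally show ?thesis .
qed

text \<open>Layer-cake argument: exchange sum and integral, replace the weights by the indicator of
  lying outside \<open>T\<close> at each height, and exchange back.\<close>

lemma sum_integral_low_fraction:
  assumes T: "is_top w T {1..n}" and w: "\<And>i. i \<in> {1..n} \<Longrightarrow> 0 \<le> w i"
  shows "(\<Sum>i\<in>{1..n}. integral {0..w i} (low_fraction n w (card T))) = sum w ({1..n} - T)"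
proof -
  \<comment> \<open>A common bound on all heights, so that the integrals can run over one
    interval.\<close>
  define W where "W = sum w {1..n}"
  define h where "h = low_fraction n w (card T)"
  have W: "w i \<le> W" if "i \<in> {1..n}" for i
    unfolding W_def using w that by (intro member_le_sum) auto
  have int: "(\<lambda>\<theta>. if \<theta> \<in> {0..w i} then f \<theta> else 0) integrable_on {0..W}"
    if "i \<in> {1..n}" "antimono f" for i and f :: "real \<Rightarrow> real"
    using W[OF that(1)] that(2)
    by (simp only: integrable_restrict_Int) (simp add: Int_absorb2 integrable_antimono)
  have restrict: "integral {0..w i} f = integral {0..W} (\<lambda>\<theta>. if \<theta> \<in> {0..w i} then f \<theta> else 0)"
    if "i \<in> {1..n}" for i and f :: "real \<Rightarrow> real"
    using W[OF that] by (simp add: integral_restrict_Int Int_absorb2 del: atLeastAtMost_iff)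
  have swap: "(\<Sum>i\<in>I. integral {0..w i} f)
      = integral {0..W} (\<lambda>\<theta>. \<Sum>i\<in>I. if \<theta> \<in> {0..w i} then f \<theta> else 0)"
    if "I \<subseteq> {1..n}" "antimono f" for I and f :: "real \<Rightarrow> real"
  proof -
    have "finite I" using that(1) finite_subset by blast
    then have "integral {0..W} (\<lambda>\<theta>. \<Sum>i\<in>I. if \<theta> \<in> {0..w i} then f \<theta> else 0)
      = (\<Sum>i\<in>I. integral {0..W} (\<lambda>\<theta>. if \<theta> \<in> {0..w i} then f \<theta> else 0))"
      by (intro integral_sum int that(2) subsetD[OF that(1)])
    also have "\<dots> = (\<Sum>i\<in>I. integral {0..w i} f)"
      using that(1) by (intro sum.cong refl restrict[symmetric]) auto
    finally show ?thesis by simp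
  qed
  have "(\<Sum>i\<in>{1..n}. integral {0..w i} h)
      = integral {0..W} (\<lambda>\<theta>. \<Sum>i\<in>{1..n}. if \<theta> \<in> {0..w i} then h \<theta> else 0)"
    unfolding h_def by (intro swap antimono_low_fraction order_refl)
  also have "\<dots> = integral {0..W} (\<lambda>\<theta>. \<Sum>i\<in>{1..n} - T. if \<theta> \<in> {0..w i} then 1 else 0)"
  proof (rule integral_cong)
    fix \<theta> assume "\<theta> \<in> {0..W}"
    then show "(\<Sum>i\<in>{1..n}. if \<theta> \<in> {0..w i} then h \<theta> else 0)
      = (\<Sum>i\<in>{1..n} - T. if \<theta> \<in> {0..w i} then 1 else 0)"
      using sum_indicator_level_set[OF T, of \<theta>, folded h_def] by simp
  qed
  also have "\<dots> = (\<Sum>i\<in>{1..n} - T. integral {0..w i} (\<lambda>_. 1))"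
    by (intro swap[symmetric]) (auto simp: antimono_def)
  also have "\<dots> = sum w ({1..n} - T)" using w by (intro sum.cong) auto
  finally show ?thesis by (simp add: h_def)
qed

text \<open>Weigh the water at height \<open>\<theta>\<close> by \<open>low_fraction\<close>: the total weight is the load of the bottom nodes,
  and as the water of round \<open>t\<close> lies below \<open>\<mu> t\<close>, all of it has weight at least that of \<open>\<mu> t\<close>.\<close>

lemma water_filling_bottom_ge:
  assumes w: "w = (\<lambda>i. \<Sum>t<m. x t i)"
    and nonneg: "\<And>t i. t < m \<Longrightarrow> 0 \<le> x t i"
    and level: "\<And>t i. t < m \<Longrightarrow> 0 < x t i \<Longrightarrow> (\<Sum>s<Suc t. x s i) = \<mu> t"
    and T: "is_top w T {1..n}"
  shows "(\<Sum>t<m. sum (x t) {1..n} * low_fraction n w (card T) (\<mu> t)) \<le> sum w ({1..n} - T)"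
proof -
  define h where "h = low_fraction n w (card T)"
  define H where "H a = integral {0..a} h" for a
  have "(\<Sum>t<m. sum (x t) {1..n} * h (\<mu> t)) = (\<Sum>t<m. \<Sum>i\<in>{1..n}. x t i * h (\<mu> t))"
    by (simp add: sum_distrib_right)
  also have "\<dots> \<le> (\<Sum>t<m. \<Sum>i\<in>{1..n}. H (\<Sum>s<Suc t. x s i) - H (\<Sum>s<t. x s i))"
  proof (intro sum_mono)
    fix t i assume t: "t \<in> {..<m}"
    show "x t i * h (\<mu> t) \<le> H (\<Sum>s<Suc t. x s i) - H (\<Sum>s<t. x s i)"
    proof (cases "x t i = 0")
      case False
      then have pos: "0 < x t i" using nonneg[of t i] t by (simp add: order_less_le)
      have "0 \<le> (\<Sum>s<t. x s i)" using t by (intro sum_nonneg nonneg) auto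
      then show ?thesis
        using integral_antimono_increment[OF antimono_low_fraction, of "\<Sum>s<t. x s i" "\<Sum>s<Suc t. x s i" n w "card T"]
          pos level[of t i, symmetric] t by (simp add: H_def h_def)
    qed simp
  qed
  also have "\<dots> = (\<Sum>i\<in>{1..n}. \<Sum>t<m. H (\<Sum>s<Suc t. x s i) - H (\<Sum>s<t. x s i))"
    by (rule sum.swap)
  also have "\<dots> = (\<Sum>i\<in>{1..n}. H (w i) - H 0)"
    
  proof (intro sum.cong refl)
    fix i
    show "(\<Sum>t<m. H (\<Sum>s<Suc t. x s i) - H (\<Sum>s<t. x s i)) = H (w i) - H 0"
      using sum_lessThan_telescope[of "\<lambda>t. H (\<Sum>s<t. x s i)" m]
      unfolding w by (simp only: lessThan_0 sum.empty)
  qed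
  also have "\<dots> = (\<Sum>i\<in>{1..n}. integral {0..w i} h)" by (simp add: H_def)
  also have "\<dots> = sum w ({1..n} - T)"
    unfolding h_def using T nonneg by (intro sum_integral_low_fraction) (auto simp: w intro!: sum_nonneg)
  finally show ?thesis by (simp add: h_def)
qed

subsection \<open>The nested adversary\<close>

lemma decreasing_chain_subset:
  assumes "\<And>k. k < m \<Longrightarrow> S (Suc k) \<subseteq> S k" "k \<le> t" "t \<le> m"
  shows "S t \<subseteq> S k"
  using assms(2,3)
proof (induction t rule: dec_induct)
  case (step t)
  then show ?case using assms(1)[of t] by auto
qed simp

text \<open>While the presented sets have at least \<open>j\<close> nodes, averaging secures the
  share \<open>j / card (S (Suc k))\<close> of each request; once a set has at most \<open>j\<close>
  nodes, it can be kept inside \<open>T\<close>, and later requests count in full.\<close>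

lemma nested_top_loads:
  fixes x :: "nat \<Rightarrow> 'a \<Rightarrow> real" and S :: "nat \<Rightarrow> 'a set" and q :: "nat \<Rightarrow> real"
  assumes fin: "finite (S 0)"
    and top: "\<And>k. k < m \<Longrightarrow> is_top (\<lambda>i. \<Sum>s<k. x s i) (S (Suc k)) (S k)"
    and nonempty: "\<And>k. k < m \<Longrightarrow> S (Suc k) \<noteq> {}"
    and sum_x: "\<And>k U. k < m \<Longrightarrow> S (Suc k) \<subseteq> U \<Longrightarrow> U \<subseteq> S 0 \<Longrightarrow> sum (x k) U = q k"
    and j: "j \<le> card (S 0)"
  shows "\<exists>T\<subseteq>S 0. card T = j \<and>
    (\<Sum>k<m. q k * min 1 (j / card (S (Suc k)))) \<le> (\<Sum>i\<in>T. \<Sum>k<m. x k i)"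
proof -
  define Y where "Y t i = (\<Sum>s<t. x s i)" for t i
  have "S (Suc k) \<subseteq> S k" if "k < m" for k using top[OF that] by (simp add: is_top_def)
  then have mono: "S t \<subseteq> S k" if "k \<le> t" "t \<le> m" for k t
    using that by (rule decreasing_chain_subset)
  have fin_S: "finite (S t)" if "t \<le> m" for t
    using mono[of 0 t] that fin finite_subset by auto
  have top_Y: "is_top (Y t) (S (Suc t)) (S t)" if "t < m" for t
    using top[OF that] by (simp add: Y_def[abs_def])
  have sum_Suc: "sum (Y (Suc t)) U = sum (Y t) U + q t" 
    if "t < m" "S (Suc t) \<subseteq> U" "U \<subseteq> S 0" for t U
    using sum_x[OF that] by (simp add: Y_def sum.distrib)
  \<comment> \<open>Restricting to a top subset does not lower the mean load, and the new request,
    placed entirely inside \<open>S (Suc t)\<close>, raises it by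
    \<open>q t / card (S (Suc t))\<close>.\<close>
  have average: "card (S t) * (\<Sum>k<t. q k / card (S (Suc k))) \<le> sum (Y t) (S t)" if "t \<le> m" for t
    using that
  proof (induction t)
    case (Suc t)
    let ?A = "\<Sum>k<t. q k / card (S (Suc k))"
    have pos: "0 < card (S (Suc t))" "0 < card (S t)"
      using Suc.prems nonempty[of t] fin_S mono[of t "Suc t"] by (auto simp: card_gt_0_iff)
    have "card (S (Suc t)) * (card (S t) * ?A) \<le> card (S (Suc t)) * sum (Y t) (S t)"
      using Suc by (intro mult_left_mono) auto
    also have "\<dots> \<le> card (S t) * sum (Y t) (S (Suc t))"
      using Suc.prems fin_S top_Y by (intro is_top_average) auto
    finally have "card (S t) * (card (S (Suc t)) * ?A) \<le> card (S t) * sum (Y t) (S (Suc t))"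
      by (simp add: mult_ac)
    then have "card (S (Suc t)) * ?A \<le> sum (Y t) (S (Suc t))"
      using pos by simp
    then show ?case
      using sum_Suc[of t "S (Suc t)"] Suc.prems mono[of 0 "Suc t"] pos by (simp add: distrib_left)
  qed (simp add: Y_def)
  have inner: "(\<Sum>k<t. q k * min 1 (card T / card (S (Suc k)))) \<le> sum (Y t) T"
    if "t \<le> m" "is_top (Y t) T (S t)" for t T
  proof (cases "t = 0")
    case False
    then have pos: "0 < card (S t)"
      using nonempty[of "t - 1"] fin_S[of t] that by (auto simp: card_gt_0_iff)
    have le: "card T \<le> card (S t)" using that fin_S by (auto simp: is_top_def intro: card_mono)
    have "min 1 (card T / card (S (Suc k))) = card T / card (S (Suc k))" if "k < t" for k
    proof -
      have "card (S t) \<le> card (S (Suc k))"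
        using that \<open>t \<le> m\<close> mono fin_S by (intro card_mono) auto
      then show ?thesis using le pos by (simp add: min_def)
    qed
    then have "(\<Sum>k<t. q k * min 1 (card T / card (S (Suc k))))
        = card T * (\<Sum>k<t. q k / card (S (Suc k)))"
      by (simp add: sum_distrib_left mult_ac)
    moreover have "card T * (card (S t) * (\<Sum>k<t. q k / card (S (Suc k)))) \<le> card T * sum (Y t) (S t)"
      using average that by (intro mult_left_mono) auto
    moreover have "card T * sum (Y t) (S t) \<le> card (S t) * sum (Y t) T"
      using that fin_S by (intro is_top_average) auto
    ultimately have "card (S t) * (\<Sum>k<t. q k * min 1 (card T / card (S (Suc k))))
        \<le> card (S t) * sum (Y t) T" by (simp add: mult_ac)
    then show ?thesis using pos by simp
  qed (simp add: Y_def)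
  \<comment> \<open>The set \<open>T\<close> is chosen at the round where the sizes first drop to
    \<open>j\<close> or below and is kept afterwards; it contains all later sets of the
    chain.\<close>
  have outer: "\<exists>T. S t \<subseteq> T \<and> T \<subseteq> S 0 \<and> card T = j \<and>
      (\<Sum>k<t. q k * min 1 (j / card (S (Suc k)))) \<le> sum (Y t) T"
    if "t \<le> m" "card (S t) \<le> j" for t
    using that
  proof (induction t)
    case 0
    then show ?case using j by (auto simp: Y_def)
  next
    case (Suc t)
    have t: "t < m" using Suc.prems by simp
    have pos: "0 < card (S (Suc t))"
      using nonempty[OF t] fin_S[OF Suc.prems(1)] by (simp add: card_gt_0_iff)
    have "\<exists>T. S (Suc t) \<subseteq> T \<and> T \<subseteq> S 0 \<and> card T = j \<and>
      (\<Sum>k<t. q k * min 1 (j / card (S (Suc k)))) \<le> sum (Y t) T"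
    proof (cases "card (S t) \<le> j")
      case True
      then obtain T where "S t \<subseteq> T" "T \<subseteq> S 0" "card T = j"
        "(\<Sum>k<t. q k * min 1 (j / card (S (Suc k)))) \<le> sum (Y t) T"
        using Suc.IH t by auto
      moreover have "S (Suc t) \<subseteq> S t" using mono[of t "Suc t"] t by simp
      ultimately show ?thesis by blast
    next
      case False
      have sub: "S (Suc t) \<subseteq> S t" using mono[of t "Suc t"] t by simp
      have fin_t: "finite (S t)" "finite (S (Suc t))" using fin_S t by auto
      have "j - card (S (Suc t)) \<le> card (S t - S (Suc t))"
        using False fin_t sub by (simp add: card_Diff_subset)
      then obtain R where R: "is_top (Y t) R (S t - S (Suc t))" "card R = j - card (S (Suc t))"
        using is_top_exists[OF finite_Diff[OF fin_t(1)]] by blast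
      \<comment> \<open>The crossing round: filling up \<open>S (Suc t)\<close> with the most loaded
        remaining nodes gives a top set of \<open>S t\<close> with \<open>j\<close> elements, to
        which \<open>inner\<close> applies.\<close>
      let ?T = "S (Suc t) \<union> R"
      have "is_top (Y t) ?T (S t)" using R(1) top_Y[OF t] by (auto simp: is_top_def)
      moreover have "card ?T = j"
      proof -
        have "R \<inter> S (Suc t) = {}" "finite R" using R(1) fin_t finite_subset by (auto simp: is_top_def)
        then show ?thesis using R(2) Suc.prems fin_t by (subst card_Un_disjoint) auto
      qed
      ultimately show ?thesis
        using inner[of t ?T] t mono[of 0 t] by (intro exI[of _ ?T]) (auto simp: is_top_def)
    qed
    then obtain T where T: "S (Suc t) \<subseteq> T" "T \<subseteq> S 0" "card T = j"
      "(\<Sum>k<t. q k * min 1 (j / card (S (Suc k)))) \<le> sum (Y t) T" by blast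
    moreover have "min 1 (j / card (S (Suc t))) = 1" using Suc.prems pos by (simp add: min_def)
    ultimately show ?case using sum_Suc[OF t T(1,2)] by (intro exI[of _ T]) auto
  qed
  show ?thesis
  proof (cases "card (S m) \<le> j")
    case True
    then show ?thesis using outer[of m] by (auto simp: Y_def)
  next
    case False
    then obtain T where "is_top (Y m) T (S m)" "card T = j"
      using is_top_exists[OF fin_S[of m], of j "Y m"] by auto
    then show ?thesis
      using inner[of m T] mono[of 0 m] by (intro exI[of _ T]) (auto simp: is_top_def Y_def)
  qed
qed

text \<open>Peel off the outermost sets: the induction hypothesis for the shifted chains gives a
  bijection on \<open>S 1\<close>, which is glued to any bijection between the equally large outer
  rings.\<close>

lemma nested_sets_bij:
  fixes S C :: "nat \<Rightarrow> 'a set"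
  assumes "\<And>k. k < m \<Longrightarrow> S (Suc k) \<subseteq> S k" "\<And>k. k < m \<Longrightarrow> C (Suc k) \<subseteq> C k"
    and "\<And>k. k \<le> m \<Longrightarrow> card (S k) = card (C k)" "finite (S 0)" "finite (C 0)"
  shows "\<exists>\<pi>. bij_betw \<pi> (S 0) (C 0) \<and> (\<forall>k\<le>m. \<pi> ` S k = C k)"
  using assms
proof (induction m arbitrary: S C)
  case 0
  then obtain \<pi> where "bij_betw \<pi> (S 0) (C 0)" using finite_same_card_bij by (metis order_refl)
  then show ?case by (auto simp: bij_betw_def)
next
  case (Suc m)
  have fin: "finite (S 1)" "finite (C 1)" using Suc.prems finite_subset by fastforce+
  have "\<exists>\<pi>. bij_betw \<pi> (S (Suc 0)) (C (Suc 0)) \<and> (\<forall>k\<le>m. \<pi> ` S (Suc k) = C (Suc k))"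
    using Suc.prems fin by (intro Suc.IH[of "\<lambda>k. S (Suc k)" "\<lambda>k. C (Suc k)"]) auto
  then obtain \<pi> where \<pi>: "bij_betw \<pi> (S 1) (C 1)" "\<And>k. k \<le> m \<Longrightarrow> \<pi> ` S (Suc k) = C (Suc k)"
    by auto
  have sub: "S 1 \<subseteq> S 0" "C 1 \<subseteq> C 0" "card (S 0) = card (C 0)" "card (S 1) = card (C 1)"
    using Suc.prems(1,2)[of 0] Suc.prems(3)[of 0] Suc.prems(3)[of 1] by auto
  then have "card (S 0 - S 1) = card (C 0 - C 1)" using fin by (simp add: card_Diff_subset)
  then obtain \<rho> where \<rho>: "bij_betw \<rho> (S 0 - S 1) (C 0 - C 1)"
    using finite_same_card_bij Suc.prems(4,5) by (metis finite_Diff)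
  define \<sigma> where "\<sigma> i = (if i \<in> S 1 then \<pi> i else \<rho> i)" for i
  have "bij_betw \<sigma> (S 1) (C 1)" "bij_betw \<sigma> (S 0 - S 1) (C 0 - C 1)"
    using \<pi>(1) \<rho> bij_betw_cong[of "S 1" \<sigma> \<pi>] bij_betw_cong[of "S 0 - S 1" \<sigma> \<rho>]
    by (auto simp: \<sigma>_def)
  then have "bij_betw \<sigma> (S 1 \<union> (S 0 - S 1)) (C 1 \<union> (C 0 - C 1))"
    by (rule bij_betw_combine) auto
  then have "bij_betw \<sigma> (S 0) (C 0)" using sub by (simp add: Un_absorb1)
  moreover have "\<sigma> ` S k = C k" if "k \<le> Suc m" for k
  proof (cases k)
    case 0
    then show ?thesis using \<open>bij_betw \<sigma> (S 0) (C 0)\<close> by (simp add: bij_betw_def)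
  next
    case (Suc k')
    have "S (Suc k') \<subseteq> S 1"
      using decreasing_chain_subset[of "Suc m" S 1 "Suc k'", OF Suc.prems(1)] that Suc by simp
    then have "\<sigma> ` S k = \<pi> ` S (Suc k')" using Suc by (auto simp: \<sigma>_def)
    then show ?thesis using \<pi>(2)[of k'] that Suc by simp
  qed
  ultimately show ?case by blast
qed

lemma majorizes_permute:
  assumes \<pi>: "bij_betw \<pi> {1..n} {1..n}" and y: "\<And>i. i \<in> {1..n} \<Longrightarrow> y i = x (\<pi> i)"
  shows "majorizes n x y"
  unfolding majorizes_def
proof (intro conjI ballI)
  have "(\<Sum>i\<in>{1..n}. x i) = (\<Sum>i\<in>{1..n}. x (\<pi> i))"
    using sum.reindex_bij_betw[OF \<pi>, of x] by simp
  then show "(\<Sum>i\<in>{1..n}. x i) = (\<Sum>i\<in>{1..n}. y i)" using y by simp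
  fix j assume "j \<in> {1..n}"
  then obtain T where T: "is_top y T {1..n}" "card T = j" "sum_largest n j y = sum y T"
    using sum_largest_top_exists[of j n y] by auto
  have sub: "T \<subseteq> {1..n}" using T by (simp add: is_top_def)
  then have inj: "inj_on \<pi> T" using \<pi> inj_on_subset by (auto simp: bij_betw_def)
  have "sum y T = sum x (\<pi> ` T)"
    using sub y by (simp add: sum.reindex[OF inj] subset_iff)
  also have "\<dots> \<le> sum_largest n (card (\<pi> ` T)) x"
    using sub \<pi> by (intro sum_largest_ge) (auto simp: bij_betw_def)
  finally show "sum_largest n j y \<le> sum_largest n j x" using T card_image[OF inj] by simp
qed

lemma sum_list_map_nth_perm:
  assumes "mset ts = mset [0..<m]"
  shows "(\<Sum>t\<leftarrow>ts. f t) = (\<Sum>t<m. f t :: 'a :: comm_monoid_add)"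
proof -
  have "(\<Sum>t\<leftarrow>ts. f t) = (\<Sum>t\<leftarrow>[0..<m]. f t)"
    using assms by (metis mset_map sum_mset_sum_list)
  then show ?thesis by (simp add: interv_sum_list_conv_sum_set_nat atLeast0LessThan)
qed

text \<open>Three changes at once: rounds are reordered by \<open>ts\<close>, neighbourhoods
  enlarged, and nodes renamed by \<open>\<pi>\<close>. Pulling each allocation back along
  \<open>\<pi>\<close> keeps it feasible.\<close>

lemma Delta_seq_relabel:
  assumes \<pi>: "bij_betw \<pi> {1..n} {1..n}"
    and ts: "mset ts = mset [0..<length E]" and len: "length R = length E"
    and R: "\<And>k. k < length E \<Longrightarrow> fst (R ! k) \<subseteq> {1..n} \<and> snd (R ! k) = snd (E ! (ts ! k))
      \<and> fst (E ! (ts ! k)) \<subseteq> \<pi> ` fst (R ! k)"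
    and x: "x \<in> Delta_seq n E"
  shows "(\<lambda>i. if i \<in> {1..n} then x (\<pi> i) else 0) \<in> Delta_seq n R"
proof -
  obtain xs where xs: "x = total xs" "list_all2 (\<lambda>x e. x \<in> Delta n e) xs E"
    using x by (auto simp: Delta_seq_def)
  have len_ts: "length ts = length E" and set_ts: "set ts = {0..<length E}"
    using arg_cong[OF ts, of size] arg_cong[OF ts, of set_mset] by auto
  define z where "z t = (\<lambda>i. if i \<in> {1..n} then (xs ! t) (\<pi> i) else 0)" for t
  have "total (map z ts) = (\<lambda>i. if i \<in> {1..n} then x (\<pi> i) else 0)"
    using xs list_all2_lengthD[OF xs(2)]
    by (auto simp: total_def[of "map z ts"] o_def sum_list_map_nth_perm[OF ts] z_def total_nth fun_eq_iff)
  moreover have "list_all2 (\<lambda>x e. x \<in> Delta n e) (map z ts) R"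
    unfolding list_all2_conv_all_nth
  proof (intro conjI allI impI)
    show "length (map z ts) = length R" using len len_ts by simp
    fix k assume "k < length (map z ts)"
    then have k: "k < length E" "ts ! k < length E" using len_ts set_ts nth_mem[of k ts] by auto
    have D: "xs ! (ts ! k) \<in> Delta n (E ! (ts ! k))" using xs k by (auto simp: list_all2_conv_all_nth)
    have "sum (z (ts ! k)) {1..n} = (\<Sum>i\<in>{1..n}. (xs ! (ts ! k)) (\<pi> i))" by (simp add: z_def)
    also have "\<dots> = sum (xs ! (ts ! k)) {1..n}" using \<pi> by (rule sum.reindex_bij_betw)
    finally have "sum (z (ts ! k)) {1..n} = snd (R ! k)" using D R[OF k(1)] by (simp add: Delta_def)
    moreover have "z (ts ! k) i = 0" if "i \<notin> fst (R ! k)" for i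
    proof (cases "i \<in> {1..n}")
      case True
      have "inj_on \<pi> {1..n}" "fst (R ! k) \<subseteq> {1..n}" using \<pi> R[OF k(1)] by (auto simp: bij_betw_def)
      then have "\<pi> i \<notin> \<pi> ` fst (R ! k)" using that True by (simp add: inj_on_image_mem_iff)
      then show ?thesis using D R[OF k(1)] by (auto simp: z_def Delta_def)
    qed (auto simp: z_def)
    ultimately show "map z ts ! k \<in> Delta n (R ! k)"
      using D k len_ts by (auto simp: Delta_def z_def)
  qed
  ultimately show ?thesis by (auto simp: Delta_seq_def intro!: exI[of _ "map z ts"])
qed

section \<open>The adaptive request sequence\<close>

definition current_nodes :: "nat \<Rightarrow> request list \<Rightarrow> nat set" where
  "current_nodes n es = (if es = [] then {1..n} else fst (last es))"

text \<open>Sizes \<open>g\<close> and quantities \<open>p\<close> are fixed in advance; only the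
  identity of the nodes depends on the policy. As \<open>g 0\<close> is the size of the initial node
  set, round \<open>k\<close>, counted from 0, presents \<open>g (Suc k)\<close> nodes.\<close>

definition nested_adversary :: "nat \<Rightarrow> (nat \<Rightarrow> nat) \<Rightarrow> (nat \<Rightarrow> real) \<Rightarrow> adversary" where
  "nested_adversary n g p es xs =
     (SOME T. is_top (total xs) T (current_nodes n es) \<and> card T = g (Suc (length es)), p (length es))"

lemma nested_adversary_run:
  assumes g0: "g 0 = n" and g: "\<And>k. k < m \<Longrightarrow> 1 \<le> g (Suc k) \<and> g (Suc k) \<le> g k"
    and p: "\<And>k. k < m \<Longrightarrow> 0 < p k" and P: "allocation_policy n P"
  obtains S x where "S 0 = {1..n}" "\<And>k. k \<le> m \<Longrightarrow> card (S k) = g k" "\<And>k. k \<le> m \<Longrightarrow> S k \<subseteq> {1..n}"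
    and "\<And>k. k < m \<Longrightarrow> is_top (\<lambda>i. \<Sum>s<k. x s i) (S (Suc k)) (S k)"
    and "\<And>k. k < m \<Longrightarrow> x k \<in> Delta n (S (Suc k), p k)"
    and "realized_seq P (nested_adversary n g p) m = map (\<lambda>k. (S (Suc k), p k)) [0..<m]"
    and "final_alloc P (nested_adversary n g p) m = (\<lambda>i. \<Sum>k<m. x k i)"
proof -
  define F where "F = nested_adversary n g p"
  define S where "S k = current_nodes n (fst (run P F k))" for k
  define x where "x k = P (fst (run P F (Suc k))) (snd (run P F k))" for k
  have load: "total (snd (run P F t)) = (\<lambda>i. \<Sum>s<t. x s i)" for t
    by (rule ext) (simp add: total_run x_def del: run.simps(2))
  have S_Suc: "S (Suc k) = fst (F (fst (run P F k)) (snd (run P F k)))" for k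
    by (simp add: S_def current_nodes_def run_Suc del: run.simps(2))
  have F_fst: "fst (F es xs)
      = (SOME T. is_top (total xs) T (current_nodes n es) \<and> card T = g (Suc (length es)))" for es xs
    by (simp add: F_def nested_adversary_def)
  have F_snd: "snd (F (fst (run P F k)) (snd (run P F k))) = p k" for k
    by (simp add: F_def nested_adversary_def run_lengths)
  have seq: "fst (run P F t) = map (\<lambda>k. (S (Suc k), p k)) [0..<t]" for t
    by (induction t) (simp_all add: run_Suc S_Suc flip: F_snd del: run.simps(2))
  have allocs: "snd (run P F t) = map x [0..<t]" for t
    by (induction t) (simp_all add: run_Suc(2) x_def del: run.simps(2))
  have S0: "S 0 = {1..n}" by (simp add: S_def current_nodes_def)
  have step: "is_top (\<lambda>i. \<Sum>s<k. x s i) (S (Suc k)) (S k) \<and> card (S (Suc k)) = g (Suc k)"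
    if "k < m" "card (S k) = g k" "finite (S k)" for k
  proof -
    have "\<exists>T. is_top (\<lambda>i. \<Sum>s<k. x s i) T (S k) \<and> card T = g (Suc k)"
      using that g by (intro is_top_exists) auto
    from someI_ex[OF this] show ?thesis
      unfolding S_Suc F_fst run_lengths load S_def[symmetric] .
  qed
  have S: "card (S k) = g k \<and> S k \<subseteq> {1..n}" if "k \<le> m" for k
    using that
  proof (induction k)
    case (Suc k)
    then have "finite (S k)" using finite_subset by auto
    then show ?case using step[of k] Suc by (auto simp: is_top_def)
  qed (simp add: S0 g0)
  have top: "is_top (\<lambda>i. \<Sum>s<k. x s i) (S (Suc k)) (S k)" if "k < m" for k
    using step[OF that] S[of k] that finite_subset by auto
  have request: "is_request n (S (Suc k), p k)" if "k < m" for k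
    using S[of "Suc k"] g[OF that] p[OF that] that by (auto simp: is_request_def)
  \<comment> \<open>\<open>allocation_policy\<close> promises a feasible answer only after feasible
    past allocations, hence strong induction.\<close>
  have D: "x k \<in> Delta n (S (Suc k), p k)" if "k < m" for k
    using that
  proof (induction k rule: less_induct)
    case (less k)
    have "P (map (\<lambda>k. (S (Suc k), p k)) [0..<k] @ [(S (Suc k), p k)]) (map x [0..<k]) \<in> Delta n (S (Suc k), p k)"
      using less request P[unfolded allocation_policy_def, rule_format,
          of "map (\<lambda>k. (S (Suc k), p k)) [0..<k]" "(S (Suc k), p k)" "map x [0..<k]"]
      by (auto simp: list_all2_conv_all_nth)
    then show ?case using x_def[of k, unfolded seq allocs] by simp
  qed
  show ?thesis
    using that[of S x] S0 S top D seq[of m] load[of m]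
    by (simp add: F_def realized_seq_def final_alloc_def)
qed

theorem theorem4:
  fixes n m :: nat and q :: real
    and M :: "'w measure" and A :: "'w \<Rightarrow> policy" and E :: "request list"
  assumes "q > 0"
    and "prob_space M"
    and "\<forall>\<omega>\<in>space M. allocation_policy n (A \<omega>)"
    and "E \<in> request_seqs n m q"
  shows "\<exists>E'\<in>adaptive_request_seqs n m q. AE \<omega> in M.
           majorizes n (final_alloc (A \<omega>) E' m) (WF n E) \<and>
           majorizes n (OPT n E) (OPT n (realized_seq (A \<omega>) E' m))"
proof -
  have E: "length E = m" "\<forall>e\<in>set E. is_request n e" "(\<Sum>e\<leftarrow>E. snd e) = q"
    using assms(4) by (auto simp: request_seqs_def)
  have request: "is_request n (E ! t)" if "t < m" for t using E that by simp
  obtain x \<mu> where WF: "WF n E = (\<lambda>i. \<Sum>t<m. x t i)"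
    and x: "\<And>t. t < m \<Longrightarrow> x t \<in> Delta n (E ! t)"
    and level_le: "\<And>t i. t < m \<Longrightarrow> i \<in> fst (E ! t) \<Longrightarrow> \<mu> t \<le> (\<Sum>s<Suc t. x s i)"
    and level_eq: "\<And>t i. t < m \<Longrightarrow> 0 < x t i \<Longrightarrow> (\<Sum>s<Suc t. x s i) = \<mu> t"
    using WF_levels[OF E(2)] unfolding E(1) by blast
  define w where "w = WF n E"
  define U where "U \<theta> = {i\<in>{1..n}. \<theta> \<le> w i}" for \<theta>
  have x_nonneg: "0 \<le> x t i" if "t < m" for t i using x[OF that] by (simp add: Delta_def)
  have sum_x: "sum (x t) {1..n} = snd (E ! t)" if "t < m" for t using x[OF that] by (simp add: Delta_def)
  have sum_q: "(\<Sum>t<m. snd (E ! t)) = q"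
    using E by (simp add: sum_list_sum_nth atLeast0LessThan)
  \<comment> \<open>Loads never decrease, so a node that reaches \<open>\<mu> t\<close> in round
    \<open>t\<close> is still at that level at the end.\<close>
  have nodes_U: "fst (E ! t) \<subseteq> U (\<mu> t)" if t: "t < m" for t
  proof
    fix i assume i: "i \<in> fst (E ! t)"
    have "\<mu> t \<le> (\<Sum>s<Suc t. x s i)" using level_le[OF t i] .
    also have "\<dots> \<le> (\<Sum>s<m. x s i)" using t x_nonneg by (intro sum_mono2) auto
    finally show "i \<in> U (\<mu> t)" using i request[OF t] by (auto simp: U_def w_def WF is_request_def)
  qed

  \<comment> \<open>Increasing levels make the enlarged neighbourhoods a decreasing chain.\<close>
  define ts where "ts = sort_key \<mu> [0..<m]"
  have mset_ts: "mset ts = mset [0..<m]" by (simp add: ts_def)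
  have len_ts: "length ts = m" and set_ts: "set ts = {0..<m}" by (simp_all add: ts_def)
  have ts_less: "ts ! k < m" if "k < m" for k using that set_ts len_ts nth_mem[of k ts] by simp
  have sum_ts: "(\<Sum>k<m. f (ts ! k)) = (\<Sum>t<m. f t)" for f :: "nat \<Rightarrow> real"
    using sum_list_map_nth_perm[OF mset_ts, of f] len_ts
    by (simp add: sum_list_sum_nth atLeast0LessThan)
  define C where "C k = (case k of 0 \<Rightarrow> {1..n} | Suc k \<Rightarrow> U (\<mu> (ts ! k)))" for k
  define g where "g k = card (C k)" for k
  define p where "p k = snd (E ! (ts ! k))" for k
  have C_decreasing: "C (Suc k) \<subseteq> C k" if "k < m" for k
  proof (cases k)
    case (Suc l)
    have "\<mu> (ts ! l) \<le> \<mu> (ts ! k)"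
      using sorted_nth_mono[of "map \<mu> ts" l k] that Suc len_ts by (simp add: ts_def)
    then show ?thesis using Suc by (auto simp: C_def U_def)
  qed (auto simp: C_def U_def)
  have g0: "g 0 = n" by (simp add: g_def C_def)
  have fin_C: "finite (C k)" for k by (cases k) (auto simp: C_def U_def)
  have g: "1 \<le> g (Suc k) \<and> g (Suc k) \<le> g k" if "k < m" for k
  proof -
    have "C (Suc k) \<noteq> {}"
      using nodes_U[OF ts_less[OF that]] request[OF ts_less[OF that]] by (auto simp: C_def is_request_def)
    then show ?thesis
      using C_decreasing[OF that] fin_C by (simp add: g_def card_mono Suc_le_eq card_gt_0_iff)
  qed
  have p: "0 < p k" if "k < m" for k
    using request[OF ts_less[OF that]] by (simp add: p_def is_request_def)
  define F where "F = nested_adversary n g p"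
  \<comment> \<open>Everything is proved for an arbitrary deterministic policy. The adversary
    \<open>F\<close> is built from \<open>E\<close> alone, so the same \<open>F\<close> serves every
    outcome of the randomness.\<close>
  have main: "realized_seq P F m \<in> request_seqs n m q \<and> majorizes n (final_alloc P F m) w \<and>
      majorizes n (OPT n E) (OPT n (realized_seq P F m))" if P: "allocation_policy n P" for P
  proof -
    obtain S y where S0: "S 0 = {1..n}" and card_S: "\<And>k. k \<le> m \<Longrightarrow> card (S k) = g k"
      and S_sub: "\<And>k. k \<le> m \<Longrightarrow> S k \<subseteq> {1..n}"
      and S_top: "\<And>k. k < m \<Longrightarrow> is_top (\<lambda>i. \<Sum>s<k. y s i) (S (Suc k)) (S k)"
      and y: "\<And>k. k < m \<Longrightarrow> y k \<in> Delta n (S (Suc k), p k)"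
      and seq: "realized_seq P F m = map (\<lambda>k. (S (Suc k), p k)) [0..<m]"
      and alloc: "final_alloc P F m = (\<lambda>i. \<Sum>k<m. y k i)"
      unfolding F_def
      by (rule nested_adversary_run[where m = m and g = g and p = p, OF g0 g p P];
          (assumption | rule that[unfolded F_def]; assumption))
    define R where "R = map (\<lambda>k. (S (Suc k), p k)) [0..<m]"
    have S_nonempty: "S (Suc k) \<noteq> {}" if "k < m" for k
      using card_S[of "Suc k"] g[OF that] that by auto
    have S_request: "is_request n (S (Suc k), p k)" if "k < m" for k
      using S_nonempty[OF that] S_sub[of "Suc k"] p[OF that] that by (simp add: is_request_def)
    have "(\<Sum>k<m. p k) = q"
      using sum_ts[of "\<lambda>t. snd (E ! t)"] sum_q by (simp add: p_def)
    then have R: "R \<in> request_seqs n m q" "\<forall>e\<in>set R. is_request n e"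
      using S_request
      by (auto simp: R_def request_seqs_def o_def interv_sum_list_conv_sum_set_nat atLeast0LessThan)

    have "majorizes n (\<lambda>i. \<Sum>k<m. y k i) w"
      unfolding majorizes_def
    proof (intro conjI ballI)
      have sum_w: "sum w {1..n} = q"
        using sum_x sum_q unfolding w_def WF by (subst sum.swap) simp
      have "(\<Sum>i\<in>{1..n}. \<Sum>k<m. y k i) = (\<Sum>k<m. p k)"
        using y by (subst sum.swap) (simp add: Delta_def)
      then show "(\<Sum>i\<in>{1..n}. \<Sum>k<m. y k i) = (\<Sum>i\<in>{1..n}. w i)"
        using sum_w \<open>(\<Sum>k<m. p k) = q\<close> by simp
      fix j assume "j \<in> {1..n}"
      then have j: "j \<le> n" by simp
      obtain T where T: "is_top w T {1..n}" "card T = j" "sum_largest n j w = sum w T"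
        using sum_largest_top_exists[OF j] by blast
      have T_sub: "T \<subseteq> {1..n}" using T by (simp add: is_top_def)
      have "\<exists>T'\<subseteq>S 0. card T' = j \<and>
        (\<Sum>k<m. p k * min 1 (j / card (S (Suc k)))) \<le> (\<Sum>i\<in>T'. \<Sum>k<m. y k i)"
      proof (rule nested_top_loads)
        fix k V assume k: "k < m" and "S (Suc k) \<subseteq> V" "V \<subseteq> S 0"
        then show "sum (y k) V = p k"
          using Delta_sum_superset[OF y[OF k] S_request[OF k], of V] S0 finite_subset[of V "{1..n}"] by simp
      qed (use S0 S_top S_nonempty j in auto)
      then obtain T' where T': "T' \<subseteq> {1..n}" "card T' = j"
        "(\<Sum>k<m. p k * min 1 (j / card (S (Suc k)))) \<le> (\<Sum>i\<in>T'. \<Sum>k<m. y k i)"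
        using S0 by auto
      \<comment> \<open>The level set is nonempty, so \<open>min 1 (j / g)\<close> and
        \<open>low_fraction\<close> add up to 1. The lower bound on the bottom nodes of
        \<open>w\<close> thus becomes an upper bound on its \<open>j\<close> largest
        entries.\<close>
      have split: "snd (E ! t) * min 1 (j / card (U (\<mu> t)))
          = snd (E ! t) - snd (E ! t) * low_fraction n w j (\<mu> t)" if t: "t < m" for t
      proof -
        have "U (\<mu> t) \<noteq> {}" using nodes_U[OF t] request[OF t] by (auto simp: is_request_def)
        then have "0 < card (U (\<mu> t))" by (simp add: card_gt_0_iff U_def)
        then have "min 1 (j / card (U (\<mu> t))) = 1 - max 0 (real (card (U (\<mu> t))) - j) / card (U (\<mu> t))"
          by (simp add: min_def max_def field_simps)
        then have "min 1 (j / card (U (\<mu> t))) = 1 - low_fraction n w j (\<mu> t)"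
          by (simp add: low_fraction_def U_def Let_def)
        then show ?thesis by (simp add: right_diff_distrib)
      qed
      have "sum w T = q - sum w ({1..n} - T)"
        using sum_w sum.subset_diff[OF T_sub, of w] by simp
      also have "\<dots> \<le> q - (\<Sum>t<m. sum (x t) {1..n} * low_fraction n w (card T) (\<mu> t))"
        using water_filling_bottom_ge[OF _ x_nonneg level_eq T(1)] by (simp add: w_def WF)
      also have "\<dots> = (\<Sum>t<m. snd (E ! t) * min 1 (j / card (U (\<mu> t))))"
        using T(2) by (simp add: split sum_x sum_subtractf sum_q del: One_nat_def)
      also have "\<dots> = (\<Sum>k<m. p k * min 1 (j / card (S (Suc k))))"
        using sum_ts[of "\<lambda>t. snd (E ! t) * min 1 (j / card (U (\<mu> t)))"]
        by (simp add: p_def card_S g_def C_def)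
      also have "\<dots> \<le> (\<Sum>i\<in>T'. \<Sum>k<m. y k i)" by fact
      also have "\<dots> \<le> sum_largest n j (\<lambda>i. \<Sum>k<m. y k i)"
        using sum_largest_ge[OF T'(1)] T'(2) by simp
      finally show "sum_largest n j w \<le> sum_largest n j (\<lambda>i. \<Sum>k<m. y k i)" using T(3) by simp
    qed
    moreover have "majorizes n (OPT n E) (OPT n R)"
    proof -
      \<comment> \<open>The presented sets and the enlarged neighbourhoods are chains of equal
        sizes, so a permutation of the nodes matches them; the optimal load of \<open>E\<close>,
        pulled back along it, is feasible for \<open>R\<close>.\<close>
      have "\<exists>\<pi>. bij_betw \<pi> (S 0) (C 0) \<and> (\<forall>k\<le>m. \<pi> ` S k = C k)"
        using S_top C_decreasing card_S S0 fin_C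
        by (intro nested_sets_bij) (auto simp: is_top_def g_def)
      then obtain \<pi> where \<pi>: "bij_betw \<pi> {1..n} {1..n}" "\<And>k. k \<le> m \<Longrightarrow> \<pi> ` S k = C k"
        using S0 by (auto simp: C_def)
      have "(\<lambda>i. if i \<in> {1..n} then OPT n E (\<pi> i) else 0) \<in> Delta_seq n R"
      proof (rule Delta_seq_relabel[OF \<pi>(1)])
        show "mset ts = mset [0..<length E]" "length R = length E"
          using mset_ts E(1) by (simp_all add: R_def)
        show "OPT n E \<in> Delta_seq n E" using OPT_least(1)[OF E(2)] .
        fix k assume "k < length E"
        then have k: "k < m" using E(1) by simp
        show "fst (R ! k) \<subseteq> {1..n} \<and> snd (R ! k) = snd (E ! (ts ! k))
          \<and> fst (E ! (ts ! k)) \<subseteq> \<pi> ` fst (R ! k)"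
          using k S_sub[of "Suc k"] \<pi>(2)[of "Suc k"] nodes_U[OF ts_less[OF k]]
          by (simp add: R_def p_def C_def)
      qed
      then have "majorizes n (\<lambda>i. if i \<in> {1..n} then OPT n E (\<pi> i) else 0) (OPT n R)"
        by (rule OPT_least(2)[OF R(2)])
      moreover have "majorizes n (OPT n E) (\<lambda>i. if i \<in> {1..n} then OPT n E (\<pi> i) else 0)"
        using \<pi>(1) by (rule majorizes_permute) simp
      ultimately show ?thesis by (rule majorizes_trans[rotated])
    qed
    ultimately show ?thesis using R(1) by (simp add: seq alloc R_def)
  qed
  show ?thesis
  proof (intro bexI[of _ F] AE_I2)
    show "F \<in> adaptive_request_seqs n m q" using main by (simp add: adaptive_request_seqs_def)
    fix \<omega> assume "\<omega> \<in> space M"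
    then show "majorizes n (final_alloc (A \<omega>) F m) (WF n E) \<and>
        majorizes n (OPT n E) (OPT n (realized_seq (A \<omega>) F m))"
      using main[of "A \<omega>"] assms(3) by (simp add: w_def)
  qed
qed

end
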